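(* Let $\bar p=(p_1,\dots,p_l)$ and let $q$ be a new variable. For every integer $d\ge0$, every $y\in \mathrm{Es}(\bar p)$ and every $x_0\in\mathrm{Es}(\bar p,q)$, if $\delta_{\bar p}(y,x_0\cap F(\bar p))<2^{-h_{l,d}(\mathcal H_0)}$, then there exists $x\in\mathrm{Es}(\bar p,q)$ such that $x\cap F(\bar p)=y$ and $\delta_{\bar p,q}(x,x_0)<2^{-d}$.
   Context: $F(\bar p)$ is the free Heyting algebra on $\bar p$, viewed as a subalgebra of $F(\bar p,q)$; IPC formulas are identified with elements of free Heyting algebras; the degree of a formula is the maximal number of nested occurrences of $\to$. $\mathrm{Es}(\bar p)$ is the set of prime filters of $F(\bar p)$. For $x,y\in\mathrm{Es}(\bar p)$, $x\sim_d y$ means that every formula $t(\bar p)$ of degree $\le d$ lies in $x$ iff it lies in $y$, and $\delta_{\bar p}(x,y)=2^{-\min\{d:\,x\not\sim_d y\}}$ (with $2^{-\infty}=0$); similarly for $\mathrm{Es}(\bar p,q)$ and $\delta_{\bar p,q}$. For $\bar a\in A^l$, $\mathrm{Th}_n(\bar a)$ is the set of formulas $\varphi(\bar p)$ of degree $\le n$ with $\varphi(\bar a)=\mathbf 1$, and $\bar a\approx_n\bar a'$ means $\mathrm{Th}_n(\bar a)=\mathrm{Th}_n(\bar a')$. A system of degree $\le d$ is $t(\bar p,q)=\mathbf 1\wedge\bigwedge_{k\le\kappa}s_k(\bar p,q)\ne\mathbf 1$ with $t,s_k$ of degree $\le d$. $h_{l,d}(A)$ is the least $n$ such that for all $\bar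 a,\bar a'\in A^l$ with $\bar a\approx_n\bar a'$ and every system $S$ of degree $\le d$, $S(\bar a,q)$ is solvable in $A$ iff $S(\bar a',q)$ is solvable in $A$ ($+\infty$ if none). $\mathcal H_0$: fix a non-trivial existentially closed Heyting algebra $\widetilde H$ (every existential formula with parameters in $\widetilde H$ true in an extension is true in $\widetilde H$); $H_0\subseteq\widetilde H$ is the two-element subalgebra; given finite $H_n\subseteq \widetilde H$, let $A_1,\dots,A_\alpha$ be its subalgebras with at most $n$ join-irreducible elements and $B_{i,1},\dots,B_{i,\beta_i}$ representatives up to isomorphism over $A_i$ of the minimal proper finite extensions of $A_i$; going through the pairs $(i,j)$ lexicographically from $C=H_n$, replace $C$ by the subalgebra of $\widetilde H$ generated by $C\cup\varphi(B)$ where $D$ is a finite Heyting algebra containing $C$ and a copy $B$ of $B_{i,j}$ containing $A_i$ and $\varphi:D\to\widetilde H$ is an embedding fixing $C$; $H_{n+1}$ is the final $C$ and $\mathcal H_0=\bigcup_n H_n$. It is known that $h_{l,d}(\mathcal H_0)<\infty$. *)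

theory Defs
  imports Complex_Main "HOL-Library.Extended_Nat"
begin

section \<open>Heyting algebras\<close>

record 'a heyting =
  carrier :: "'a set"
  meet :: "'a \<Rightarrow> 'a \<Rightarrow> 'a"
  join :: "'a \<Rightarrow> 'a \<Rightarrow> 'a"
  imp :: "'a \<Rightarrow> 'a \<Rightarrow> 'a"
  falsum :: 'a
  verum :: 'a

definition le :: "'a heyting \<Rightarrow> 'a \<Rightarrow> 'a \<Rightarrow> bool" where
  "le H a b \<longleftrightarrow> meet H a b = a"

locale heyting_algebra =
  fixes H :: "'a heyting"
  assumes meet_closed: "a \<in> carrier H \<Longrightarrow> b \<in> carrier H \<Longrightarrow> meet H a b \<in> carrier H"
    and join_closed: "a \<in> carrier H \<Longrightarrow> b \<in> carrier H \<Longrightarrow> join H a b \<in> carrier H"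
    and imp_closed: "a \<in> carrier H \<Longrightarrow> b \<in> carrier H \<Longrightarrow> imp H a b \<in> carrier H"
    and falsum_closed: "falsum H \<in> carrier H"
    and verum_closed: "verum H \<in> carrier H"
    and meet_comm: "a \<in> carrier H \<Longrightarrow> b \<in> carrier H \<Longrightarrow> meet H a b = meet H b a"
    and join_comm: "a \<in> carrier H \<Longrightarrow> b \<in> carrier H \<Longrightarrow> join H a b = join H b a"
    and meet_assoc: "a \<in> carrier H \<Longrightarrow> b \<in> carrier H \<Longrightarrow> c \<in> carrier H \<Longrightarrow>
      meet H (meet H a b) c = meet H a (meet H b c)"
    and join_assoc: "a \<in> carrier H \<Longrightarrow> b \<in> carrier H \<Longrightarrow> c \<in> carrier H \<Longrightarrow>
      join H (join H a b) c = join H a (join H b c)"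
    and meet_join_absorb: "a \<in> carrier H \<Longrightarrow> b \<in> carrier H \<Longrightarrow> meet H a (join H a b) = a"
    and join_meet_absorb: "a \<in> carrier H \<Longrightarrow> b \<in> carrier H \<Longrightarrow> join H a (meet H a b) = a"
    and falsum_le: "a \<in> carrier H \<Longrightarrow> le H (falsum H) a"
    and le_verum: "a \<in> carrier H \<Longrightarrow> le H a (verum H)"
    and residuation: "a \<in> carrier H \<Longrightarrow> b \<in> carrier H \<Longrightarrow> c \<in> carrier H \<Longrightarrow>
      le H (meet H a b) c \<longleftrightarrow> le H a (imp H b c)"

definition nontrivial :: "'a heyting \<Rightarrow> bool" where
  "nontrivial H \<longleftrightarrow> falsum H \<noteq> verum H"

definition heyting_hom :: "('a \<Rightarrow> 'b) \<Rightarrow> 'a heyting \<Rightarrow> 'b heyting \<Rightarrow> bool" where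
  "heyting_hom f A B \<longleftrightarrow> f ` carrier A \<subseteq> carrier B \<and>
     (\<forall>a\<in>carrier A. \<forall>b\<in>carrier A.
        f (meet A a b) = meet B (f a) (f b) \<and>
        f (join A a b) = join B (f a) (f b) \<and>
        f (imp A a b) = imp B (f a) (f b)) \<and>
     f (falsum A) = falsum B \<and> f (verum A) = verum B"

definition embedding :: "('a \<Rightarrow> 'b) \<Rightarrow> 'a heyting \<Rightarrow> 'b heyting \<Rightarrow> bool" where
  "embedding f A B \<longleftrightarrow> heyting_hom f A B \<and> inj_on f (carrier A)"

definition isomorphism :: "('a \<Rightarrow> 'b) \<Rightarrow> 'a heyting \<Rightarrow> 'b heyting \<Rightarrow> bool" where
  "isomorphism f A B \<longleftrightarrow> heyting_hom f A B \<and> bij_betw f (carrier A) (carrier B)"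

definition subalgebra :: "'a set \<Rightarrow> 'a heyting \<Rightarrow> bool" where
  "subalgebra S H \<longleftrightarrow> S \<subseteq> carrier H \<and> falsum H \<in> S \<and> verum H \<in> S \<and>
     (\<forall>a\<in>S. \<forall>b\<in>S. meet H a b \<in> S \<and> join H a b \<in> S \<and> imp H a b \<in> S)"

definition sub :: "'a heyting \<Rightarrow> 'a set \<Rightarrow> 'a heyting" where
  "sub H S = H\<lparr>carrier := S\<rparr>"

definition generated :: "'a heyting \<Rightarrow> 'a set \<Rightarrow> 'a set" where
  "generated H X = \<Inter>{S. subalgebra S H \<and> X \<subseteq> S}"

definition join_irreducibles :: "'a heyting \<Rightarrow> 'a set" where
  "join_irreducibles H = {a \<in> carrier H. a \<noteq> falsum H \<and>
     (\<forall>b\<in>carrier H. \<forall>c\<in>carrier H. a = join H b c \<longrightarrow> a = b \<or> a = c)}"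

definition prime_filter :: "'a heyting \<Rightarrow> 'a set \<Rightarrow> bool" where
  "prime_filter H x \<longleftrightarrow> x \<subseteq> carrier H \<and> verum H \<in> x \<and> falsum H \<notin> x \<and>
     (\<forall>a\<in>x. \<forall>b\<in>x. meet H a b \<in> x) \<and>
     (\<forall>a\<in>x. \<forall>b\<in>carrier H. le H a b \<longrightarrow> b \<in> x) \<and>
     (\<forall>a\<in>carrier H. \<forall>b\<in>carrier H. join H a b \<in> x \<longrightarrow> a \<in> x \<or> b \<in> x)"


section \<open>Intuitionistic formulas and free Heyting algebras\<close>

datatype fm = Var nat | Fls | Tru | Conj fm fm | Disj fm fm | Imp fm fm

primrec vars :: "fm \<Rightarrow> nat set" where
  "vars (Var i) = {i}"
| "vars Fls = {}"
| "vars Tru = {}"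
| "vars (Conj \<phi> \<psi>) = vars \<phi> \<union> vars \<psi>"
| "vars (Disj \<phi> \<psi>) = vars \<phi> \<union> vars \<psi>"
| "vars (Imp \<phi> \<psi>) = vars \<phi> \<union> vars \<psi>"

primrec degree :: "fm \<Rightarrow> nat" where
  "degree (Var i) = 0"
| "degree Fls = 0"
| "degree Tru = 0"
| "degree (Conj \<phi> \<psi>) = max (degree \<phi>) (degree \<psi>)"
| "degree (Disj \<phi> \<psi>) = max (degree \<phi>) (degree \<psi>)"
| "degree (Imp \<phi> \<psi>) = Suc (max (degree \<phi>) (degree \<psi>))"

primrec eval :: "'a heyting \<Rightarrow> (nat \<Rightarrow> 'a) \<Rightarrow> fm \<Rightarrow> 'a" where
  "eval H v (Var i) = v i"
| "eval H v Fls = falsum H"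
| "eval H v Tru = verum H"
| "eval H v (Conj \<phi> \<psi>) = meet H (eval H v \<phi>) (eval H v \<psi>)"
| "eval H v (Disj \<phi> \<psi>) = join H (eval H v \<phi>) (eval H v \<psi>)"
| "eval H v (Imp \<phi> \<psi>) = imp H (eval H v \<phi>) (eval H v \<psi>)"

text \<open>Derivability of \<open>\<psi>\<close> from \<open>\<phi>\<close> in IPC, presented as the least preorder on formulas
  satisfying the laws of Heyting algebras.\<close>

inductive derives :: "fm \<Rightarrow> fm \<Rightarrow> bool" (infix \<open>\<turnstile>\<close> 50) where
  refl: "\<phi> \<turnstile> \<phi>"
| cut: "\<phi> \<turnstile> \<psi> \<Longrightarrow> \<psi> \<turnstile> \<chi> \<Longrightarrow> \<phi> \<turnstile> \<chi>"
| FlsE: "Fls \<turnstile> \<phi>"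
| TruI: "\<phi> \<turnstile> Tru"
| ConjE1: "Conj \<phi> \<psi> \<turnstile> \<phi>"
| ConjE2: "Conj \<phi> \<psi> \<turnstile> \<psi>"
| ConjI: "\<chi> \<turnstile> \<phi> \<Longrightarrow> \<chi> \<turnstile> \<psi> \<Longrightarrow> \<chi> \<turnstile> Conj \<phi> \<psi>"
| DisjI1: "\<phi> \<turnstile> Disj \<phi> \<psi>"
| DisjI2: "\<psi> \<turnstile> Disj \<phi> \<psi>"
| DisjE: "\<phi> \<turnstile> \<chi> \<Longrightarrow> \<psi> \<turnstile> \<chi> \<Longrightarrow> Disj \<phi> \<psi> \<turnstile> \<chi>"
| ImpI: "Conj \<chi> \<phi> \<turnstile> \<psi> \<Longrightarrow> \<chi> \<turnstile> Imp \<phi> \<psi>"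
| ImpE: "\<chi> \<turnstile> Imp \<phi> \<psi> \<Longrightarrow> Conj \<chi> \<phi> \<turnstile> \<psi>"

definition cls :: "fm \<Rightarrow> fm set" where
  "cls \<phi> = {\<psi>. \<phi> \<turnstile> \<psi> \<and> \<psi> \<turnstile> \<phi>}"

text \<open>The classes are taken in the set of all formulas, whatever \<open>V\<close> is, so that
  \<open>free_heyting V\<close> is literally a subalgebra of \<open>free_heyting W\<close> when \<open>V \<subseteq> W\<close>.\<close>

definition free_heyting :: "nat set \<Rightarrow> fm set heyting" where
  "free_heyting V =
     \<lparr>carrier = cls ` {\<phi>. vars \<phi> \<subseteq> V},
      meet = (\<lambda>X Y. \<Union>\<phi>\<in>X. \<Union>\<psi>\<in>Y. cls (Conj \<phi> \<psi>)),
      join = (\<lambda>X Y. \<Union>\<phi>\<in>X. \<Union>\<psi>\<in>Y. cls (Disj \<phi> \<psi>)),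
      imp = (\<lambda>X Y. \<Union>\<phi>\<in>X. \<Union>\<psi>\<in>Y. cls (Imp \<phi> \<psi>)),
      falsum = cls Fls,
      verum = cls Tru\<rparr>"

lemma cls_eq_iff: "cls \<phi> = cls \<psi> \<longleftrightarrow> \<phi> \<turnstile> \<psi> \<and> \<psi> \<turnstile> \<phi>"
  unfolding cls_def by (auto intro: derives.refl derives.cut)

lemma cls_op:
  assumes "\<And>\<phi>' \<psi>'. \<phi>' \<in> cls \<phi> \<Longrightarrow> \<psi>' \<in> cls \<psi> \<Longrightarrow> cls (f \<phi>' \<psi>') = cls (f \<phi> \<psi>)"
  shows "(\<Union>\<phi>'\<in>cls \<phi>. \<Union>\<psi>'\<in>cls \<psi>. cls (f \<phi>' \<psi>')) = cls (f \<phi> \<psi>)"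
proof -
  have "\<phi> \<in> cls \<phi>" "\<psi> \<in> cls \<psi>"
    by (auto simp: cls_def intro: derives.refl)
  then show ?thesis using assms by blast
qed

lemma ConjL1: "\<phi> \<turnstile> \<chi> \<Longrightarrow> Conj \<phi> \<psi> \<turnstile> \<chi>"
  by (rule derives.cut[OF derives.ConjE1])

lemma ConjL2: "\<psi> \<turnstile> \<chi> \<Longrightarrow> Conj \<phi> \<psi> \<turnstile> \<chi>"
  by (rule derives.cut[OF derives.ConjE2])

lemma DisjR1: "\<chi> \<turnstile> \<phi> \<Longrightarrow> \<chi> \<turnstile> Disj \<phi> \<psi>"
  by (rule derives.cut[OF _ derives.DisjI1])

lemma DisjR2: "\<chi> \<turnstile> \<psi> \<Longrightarrow> \<chi> \<turnstile> Disj \<phi> \<psi>"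
  by (rule derives.cut[OF _ derives.DisjI2])

lemma Conj_mono: "\<phi> \<turnstile> \<phi>' \<Longrightarrow> \<psi> \<turnstile> \<psi>' \<Longrightarrow> Conj \<phi> \<psi> \<turnstile> Conj \<phi>' \<psi>'"
  by (blast intro: derives.ConjI ConjL1 ConjL2)

lemma Disj_mono: "\<phi> \<turnstile> \<phi>' \<Longrightarrow> \<psi> \<turnstile> \<psi>' \<Longrightarrow> Disj \<phi> \<psi> \<turnstile> Disj \<phi>' \<psi>'"
  by (blast intro: derives.DisjE DisjR1 DisjR2)

lemma Imp_mono:
  assumes "\<phi>' \<turnstile> \<phi>" "\<psi> \<turnstile> \<psi>'"
  shows "Imp \<phi> \<psi> \<turnstile> Imp \<phi>' \<psi>'"
proof (rule derives.ImpI)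
  have "Conj (Imp \<phi> \<psi>) \<phi>' \<turnstile> Conj (Imp \<phi> \<psi>) \<phi>"
    using assms(1) by (intro Conj_mono derives.refl)
  moreover have "Conj (Imp \<phi> \<psi>) \<phi> \<turnstile> \<psi>"
    by (intro derives.ImpE derives.refl)
  ultimately show "Conj (Imp \<phi> \<psi>) \<phi>' \<turnstile> \<psi>'"
    using assms(2) by (blast intro: derives.cut)
qed

lemma free_heyting_simps:
  "carrier (free_heyting V) = cls ` {\<phi>. vars \<phi> \<subseteq> V}"
  "meet (free_heyting V) (cls \<phi>) (cls \<psi>) = cls (Conj \<phi> \<psi>)"
  "join (free_heyting V) (cls \<phi>) (cls \<psi>) = cls (Disj \<phi> \<psi>)"
  "imp (free_heyting V) (cls \<phi>) (cls \<psi>) = cls (Imp \<phi> \<psi>)"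
  "falsum (free_heyting V) = cls Fls"
  "verum (free_heyting V) = cls Tru"
  unfolding free_heyting_def
  by (simp_all, (rule cls_op, simp add: cls_eq_iff, simp add: cls_def Conj_mono Disj_mono Imp_mono)+)

lemma free_heyting_le: "le (free_heyting V) (cls \<phi>) (cls \<psi>) \<longleftrightarrow> \<phi> \<turnstile> \<psi>"
  unfolding le_def free_heyting_simps cls_eq_iff
  by (blast intro: derives.refl derives.ConjI derives.ConjE1 derives.ConjE2 derives.cut)

lemma heyting_algebra_free: "heyting_algebra (free_heyting V)"
proof
  fix X Y Z assume "X \<in> carrier (free_heyting V)" "Y \<in> carrier (free_heyting V)"
    "Z \<in> carrier (free_heyting V)"
  then obtain \<phi> \<psi> \<chi> where "X = cls \<phi>" "Y = cls \<psi>" "Z = cls \<chi>"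
    by (auto simp: free_heyting_simps)
  then show "le (free_heyting V) (meet (free_heyting V) X Y) Z \<longleftrightarrow>
      le (free_heyting V) X (imp (free_heyting V) Y Z)"
    by (auto simp: free_heyting_simps free_heyting_le intro: derives.intros)
qed (clarsimp simp: free_heyting_simps free_heyting_le cls_eq_iff;
     (rule imageI, simp; fail)?;
     (blast intro: derives.FlsE derives.TruI derives.ConjI derives.DisjE
       derives.refl ConjL1 ConjL2 DisjR1 DisjR2)?)+

context heyting_algebra
begin

lemma le_refl: "a \<in> carrier H \<Longrightarrow> le H a a"
  by (metis join_meet_absorb le_def meet_closed meet_join_absorb)

lemma le_trans:
  "a \<in> carrier H \<Longrightarrow> b \<in> carrier H \<Longrightarrow> c \<in> carrier H \<Longrightarrow> le H a b \<Longrightarrow> le H b c \<Longrightarrow> le H a c"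
  by (metis le_def meet_assoc)

lemma le_antisym: "a \<in> carrier H \<Longrightarrow> b \<in> carrier H \<Longrightarrow> le H a b \<Longrightarrow> le H b a \<Longrightarrow> a = b"
  by (metis le_def meet_comm)

lemma le_iff_join: "a \<in> carrier H \<Longrightarrow> b \<in> carrier H \<Longrightarrow> le H a b \<longleftrightarrow> join H a b = b"
  by (metis join_comm join_meet_absorb le_def meet_comm meet_join_absorb)

lemma eval_closed: "(\<And>i. i \<in> vars \<phi> \<Longrightarrow> v i \<in> carrier H) \<Longrightarrow> eval H v \<phi> \<in> carrier H"
  by (induction \<phi>)
    (auto intro: meet_closed join_closed imp_closed falsum_closed verum_closed)

lemma soundness:
  assumes "\<And>i. v i \<in> carrier H"
  shows "\<phi> \<turnstile> \<psi> \<Longrightarrow> le H (eval H v \<phi>) (eval H v \<psi>)"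
proof (induction rule: derives.induct)
  case (refl \<phi>)
  then show ?case by (simp add: le_refl eval_closed assms)
next
  case (cut \<phi> \<psi> \<chi>)
  then show ?case by (meson le_trans eval_closed assms)
next
  case (FlsE \<phi>)
  then show ?case by (simp add: falsum_le eval_closed assms)
next
  case (TruI \<phi>)
  then show ?case by (simp add: le_verum eval_closed assms)
next
  case (ConjE1 \<phi> \<psi>)
  then show ?case
    by simp (metis assms eval_closed le_iff_join join_meet_absorb join_comm meet_closed)
next
  case (ConjE2 \<phi> \<psi>)
  then show ?case
    by simp (metis assms eval_closed le_iff_join join_meet_absorb join_comm meet_closed meet_comm)
next
  case (ConjI \<chi> \<phi> \<psi>)
  then show ?case
    by (simp add: le_def) (metis assms eval_closed meet_assoc)
next
  case (DisjI1 \<phi> \<psi>)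
  then show ?case
    by (simp add: le_def meet_join_absorb eval_closed assms)
next
  case (DisjI2 \<psi> \<phi>)
  then show ?case
    by (simp add: le_def) (metis assms eval_closed meet_join_absorb join_comm)
next
  case (DisjE \<phi> \<chi> \<psi>)
  then show ?case
    by simp (metis assms eval_closed join_assoc join_closed le_iff_join)
next
  case (ImpI \<chi> \<phi> \<psi>)
  then show ?case by (simp add: residuation eval_closed assms)
next
  case (ImpE \<chi> \<phi> \<psi>)
  then show ?case by (simp add: residuation eval_closed assms)
qed

end

lemma eval_cong: "(\<And>i. i \<in> vars \<phi> \<Longrightarrow> v i = w i) \<Longrightarrow> eval H v \<phi> = eval H w \<phi>"
  by (induction \<phi>) auto

theorem free_heyting_universal:
  assumes "heyting_algebra H" "\<And>i. i \<in> V \<Longrightarrow> v i \<in> carrier H"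
  shows "\<exists>f. heyting_hom f (free_heyting V) H \<and> (\<forall>i\<in>V. f (cls (Var i)) = v i) \<and>
    (\<forall>g. heyting_hom g (free_heyting V) H \<and> (\<forall>i\<in>V. g (cls (Var i)) = v i) \<longrightarrow>
      (\<forall>X\<in>carrier (free_heyting V). g X = f X))"
proof -
  interpret heyting_algebra H by fact
  define w where "w i = (if i \<in> V then v i else falsum H)" for i
  have w: "w i \<in> carrier H" for i
    by (simp add: w_def assms falsum_closed)
  define f where "f X = eval H w (SOME \<phi>. X = cls \<phi>)" for X
  have f: "f (cls \<phi>) = eval H w \<phi>" for \<phi>
  proof -
    have "cls \<phi> = cls (SOME \<psi>. cls \<phi> = cls \<psi>)"
      by (rule someI) (rule HOL.refl)
    then show ?thesis
      unfolding f_def cls_eq_iff by (meson soundness w le_antisym eval_closed)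
  qed
  have "heyting_hom f (free_heyting V) H"
    by (auto simp: heyting_hom_def free_heyting_simps f eval_closed w)
  moreover have "\<forall>i\<in>V. f (cls (Var i)) = v i"
    by (simp add: f w_def)
  moreover have "g (cls \<phi>) = f (cls \<phi>)"
    if g: "heyting_hom g (free_heyting V) H" "\<forall>i\<in>V. g (cls (Var i)) = v i" and "vars \<phi> \<subseteq> V"
    for g \<phi>
  proof -
    have hom: "g (cls (Conj \<phi> \<psi>)) = meet H (g (cls \<phi>)) (g (cls \<psi>))"
        "g (cls (Disj \<phi> \<psi>)) = join H (g (cls \<phi>)) (g (cls \<psi>))"
        "g (cls (Imp \<phi> \<psi>)) = imp H (g (cls \<phi>)) (g (cls \<psi>))"
      if "vars \<phi> \<subseteq> V" "vars \<psi> \<subseteq> V" for \<phi> \<psi>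
      using g(1) that by (auto simp: heyting_hom_def free_heyting_simps)
    have hom0: "g (cls Fls) = falsum H" "g (cls Tru) = verum H"
      using g(1) by (auto simp: heyting_hom_def free_heyting_simps)
    show ?thesis
      using that(3)
    proof (induction \<phi>)
      case (Var i)
      then show ?case using g(2) by (simp add: f w_def)
    qed (simp_all add: f hom hom0)
  qed
  ultimately show ?thesis
    unfolding free_heyting_simps(1) by blast
qed


section \<open>Existentially closed Heyting algebras\<close>

text \<open>Quantifier-free first-order formulas in the language of Heyting algebras; the terms of
  that language are the formulas of type \<open>fm\<close>.\<close>

datatype qf = Eq fm fm | Neg qf | And qf qf | Or qf qf

primrec qf_vars :: "qf \<Rightarrow> nat set" where
  "qf_vars (Eq s t) = vars s \<union> vars t"
| "qf_vars (Neg \<theta>) = qf_vars \<theta>"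
| "qf_vars (And \<theta> \<eta>) = qf_vars \<theta> \<union> qf_vars \<eta>"
| "qf_vars (Or \<theta> \<eta>) = qf_vars \<theta> \<union> qf_vars \<eta>"

primrec sat :: "'a heyting \<Rightarrow> (nat \<Rightarrow> 'a) \<Rightarrow> qf \<Rightarrow> bool" where
  "sat H v (Eq s t) \<longleftrightarrow> eval H v s = eval H v t"
| "sat H v (Neg \<theta>) \<longleftrightarrow> \<not> sat H v \<theta>"
| "sat H v (And \<theta> \<eta>) \<longleftrightarrow> sat H v \<theta> \<and> sat H v \<eta>"
| "sat H v (Or \<theta> \<eta>) \<longleftrightarrow> sat H v \<theta> \<or> sat H v \<eta>"

text \<open>\<open>existential_true H \<theta> m as\<close>: the formula \<open>\<exists>x\<^sub>1\<dots>x\<^sub>m. \<theta>(as, x\<^sub>1, \<dots>, x\<^sub>m)\<close> holds in \<open>H\<close>.\<close>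

definition existential_true :: "'a heyting \<Rightarrow> qf \<Rightarrow> nat \<Rightarrow> 'a list \<Rightarrow> bool" where
  "existential_true H \<theta> m as \<longleftrightarrow>
     (\<exists>bs. length bs = m \<and> set bs \<subseteq> carrier H \<and> sat H (\<lambda>i. (as @ bs) ! i) \<theta>)"

text \<open>An extension of \<open>H\<close> is an algebra \<open>E\<close> with an embedding of \<open>H\<close> into it. Only extensions
  carried by the type \<open>'a + nat\<close> are quantified over. This loses nothing: an existential formula
  true in an extension is already true in the subalgebra generated by \<open>H\<close> and the witnesses,
  whose cardinality is at most that of \<open>'a + nat\<close>; see \<open>existentially_closed_any\<close> below.\<close>

definition existentially_closed :: "'a heyting \<Rightarrow> bool" where
  "existentially_closed H \<longleftrightarrow> heyting_algebra H \<and>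
     (\<forall>(E :: ('a + nat) heyting) e. heyting_algebra E \<and> embedding e H E \<longrightarrow>
        (\<forall>\<theta> m as. set as \<subseteq> carrier H \<and> qf_vars \<theta> \<subseteq> {..<length as + m} \<and>
            existential_true E \<theta> m (map e as) \<longrightarrow>
          existential_true H \<theta> m as))"

lemma heyting_algebra_sub:
  assumes "heyting_algebra H" "subalgebra S H"
  shows "heyting_algebra (sub H S)"
proof -
  interpret heyting_algebra H by fact
  have "a \<in> carrier H" if "a \<in> S" for a
    using assms(2) that by (auto simp: subalgebra_def)
  then show ?thesis
    using assms(2) unfolding heyting_algebra_def
    by (simp add: sub_def subalgebra_def le_def meet_assoc join_assoc meet_join_absorb
        join_meet_absorb falsum_le[unfolded le_def] le_verum[unfolded le_def])
      (metis residuation[unfolded le_def] meet_comm join_comm meet_assoc)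
qed

lemma eval_sub: "eval (sub H S) v \<phi> = eval H v \<phi>"
  by (induction \<phi>) (auto simp: sub_def)

lemma sat_sub: "sat (sub H S) v \<theta> = sat H v \<theta>"
  by (induction \<theta>) (auto simp: eval_sub)

lemma eval_hom:
  assumes "heyting_hom f A B" "heyting_algebra A" "\<And>i. i \<in> vars \<phi> \<Longrightarrow> v i \<in> carrier A"
  shows "eval B (\<lambda>i. f (v i)) \<phi> = f (eval A v \<phi>)"
proof -
  interpret heyting_algebra A by fact
  show ?thesis
    using assms(3) by (induction \<phi>) (use assms(1) in \<open>simp_all add: heyting_hom_def eval_closed\<close>)
qed

lemma sat_embedding:
  assumes "embedding f A B" "heyting_algebra A" "\<And>i. i \<in> qf_vars \<theta> \<Longrightarrow> v i \<in> carrier A"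
  shows "sat B (\<lambda>i. f (v i)) \<theta> = sat A v \<theta>"
  using assms(3)
proof (induction \<theta>)
  case (Eq s t)
  then have "eval A v s \<in> carrier A" "eval A v t \<in> carrier A"
    by (auto intro: heyting_algebra.eval_closed[OF assms(2)])
  moreover have "eval B (\<lambda>i. f (v i)) s = f (eval A v s)"
    "eval B (\<lambda>i. f (v i)) t = f (eval A v t)"
    using assms Eq by (auto intro!: eval_hom simp: embedding_def)
  ultimately show ?case
    using assms(1) by (auto simp: embedding_def dest: inj_onD)
qed auto

lemma sat_cong: "(\<And>i. i \<in> qf_vars \<theta> \<Longrightarrow> v i = w i) \<Longrightarrow> sat H v \<theta> = sat H w \<theta>"
proof (induction \<theta>)
  case (Eq s t)
  then have "eval H v s = eval H w s" "eval H v t = eval H w t"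
    by (auto intro!: eval_cong)
  then show ?case by simp
qed auto

definition transport :: "('a \<Rightarrow> 'b) \<Rightarrow> 'a heyting \<Rightarrow> 'b heyting" where
  "transport g A = (let h = inv_into (carrier A) g in
     \<lparr>carrier = g ` carrier A,
      meet = (\<lambda>x y. g (meet A (h x) (h y))),
      join = (\<lambda>x y. g (join A (h x) (h y))),
      imp = (\<lambda>x y. g (imp A (h x) (h y))),
      falsum = g (falsum A),
      verum = g (verum A)\<rparr>)"

lemma transport:
  assumes "heyting_algebra A" "inj_on g (carrier A)"
  shows "heyting_algebra (transport g A)" and "embedding g A (transport g A)"
proof -
  interpret heyting_algebra A by fact
  note simps = transport_def Let_def le_def assms(2) inv_into_f_f meet_closed join_closed
    imp_closed falsum_closed verum_closed inj_on_eq_iff[OF assms(2)]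
  show "embedding g A (transport g A)"
    using assms(2) by (auto simp: embedding_def heyting_hom_def simps)
  show "heyting_algebra (transport g A)"
  proof
    fix x y z
    assume "x \<in> carrier (transport g A)" "y \<in> carrier (transport g A)"
      "z \<in> carrier (transport g A)"
    then show "le (transport g A) (meet (transport g A) x y) z \<longleftrightarrow>
        le (transport g A) x (imp (transport g A) y z)"
      using residuation by (auto simp: simps)
  qed (auto simp: simps meet_assoc join_assoc meet_join_absorb join_meet_absorb
      falsum_le[unfolded le_def] le_verum[unfolded le_def]
      intro!: imageI intro: arg_cong[where f = g] meet_comm join_comm)
qed

context
  includes cardinal_syntax
begin

lemma finite_small: "finite A \<Longrightarrow> infinite B \<Longrightarrow> |A| \<le>o |B|"
  by (metis card_of_Well_order card_of_ordLeq_infinite ordLeq_total)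

lemma small_subalgebra:
  fixes E :: "'b heyting" and X :: "'b set"
  assumes "heyting_algebra E" "X \<subseteq> carrier E" "|X| \<le>o |UNIV :: 'c set|"
    "infinite (UNIV :: 'c set)"
  shows "\<exists>S. subalgebra S E \<and> X \<subseteq> S \<and> |S| \<le>o |UNIV :: 'c set|"
proof -
  interpret heyting_algebra E by fact
  let ?U = "UNIV :: 'c set"
  define step where "step T = T \<union> ((\<lambda>(a, b). meet E a b) ` (T \<times> T) \<union>
    ((\<lambda>(a, b). join E a b) ` (T \<times> T) \<union> (\<lambda>(a, b). imp E a b) ` (T \<times> T)))" for T
  define T where "T n = (step ^^ n) (X \<union> {falsum E, verum E})" for n
  have T0: "T 0 = X \<union> {falsum E, verum E}" and TS: "T (Suc n) = step (T n)" for n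
    by (simp_all add: T_def)
  have Un: "|A \<union> B| \<le>o |?U|" if "|A| \<le>o |?U|" "|B| \<le>o |?U|" for A B :: "'b set"
    using that assms(4) by (intro card_of_Un_ordLeq_infinite_Field)
      (simp_all add: Field_card_of card_of_card_order_on)
  have prod: "|f ` (A \<times> A)| \<le>o |?U|" if "|A| \<le>o |?U|" for A :: "'b set" and f :: "_ \<Rightarrow> 'b"
  proof -
    have "|A \<times> A| \<le>o |?U|"
      using that assms(4) by (intro card_of_Times_ordLeq_infinite_Field)
        (simp_all add: Field_card_of card_of_card_order_on)
    with card_of_image show ?thesis by (rule ordLeq_transitive)
  qed
  have "|T n| \<le>o |?U|" for n
  proof (induction n)
    case 0
    have "|{falsum E, verum E}| \<le>o |?U|"
      by (rule finite_small[OF _ assms(4)]) simp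
    with assms(3) show ?case unfolding T0 by (rule Un)
  next
    case (Suc n)
    show ?case unfolding TS step_def by (rule Un Suc prod)+
  qed
  then have small: "|\<Union>n. T n| \<le>o |?U|"
    by (intro card_of_UNION_ordLeq_infinite[OF assms(4)])
      (simp_all add: assms(4)[unfolded infinite_iff_card_of_nat])
  have carr: "T n \<subseteq> carrier E" for n
  proof (induction n)
    case 0
    then show ?case using assms(2) by (simp add: T0 falsum_closed verum_closed)
  next
    case (Suc n)
    then have "a \<in> carrier E" if "a \<in> T n" for a
      using that by blast
    then show ?case
      unfolding TS step_def by (auto intro: meet_closed join_closed imp_closed)
  qed
  have mono: "T m \<subseteq> T n" if "m \<le> n" for m n
    using that by (rule lift_Suc_mono_le[of T, rotated]) (auto simp: TS step_def)
  have cl: "meet E a b \<in> (\<Union>n. T n) \<and> join E a b \<in> (\<Union>n. T n) \<and> imp E a b \<in> (\<Union>n. T n)"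
    if ab: "a \<in> (\<Union>n. T n)" "b \<in> (\<Union>n. T n)" for a b
  proof -
    obtain m n where "a \<in> T m" "b \<in> T n" using ab by auto
    then have "a \<in> T (max m n)" "b \<in> T (max m n)"
      using mono[of m "max m n"] mono[of n "max m n"] by auto
    then have "meet E a b \<in> T (Suc (max m n)) \<and> join E a b \<in> T (Suc (max m n)) \<and>
      imp E a b \<in> T (Suc (max m n))"
      by (auto simp: TS step_def)
    then show ?thesis by (intro conjI UN_I[of "Suc (max m n)"]) simp_all
  qed
  have "subalgebra (\<Union>n. T n) E"
    unfolding subalgebra_def
  proof (intro conjI ballI)
    show "(\<Union>n. T n) \<subseteq> carrier E" using carr by (rule UN_least)
    show "falsum E \<in> (\<Union>n. T n)" "verum E \<in> (\<Union>n. T n)" using T0 by blast+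
  qed (simp_all only: cl)
  moreover have "X \<subseteq> (\<Union>n. T n)" using T0 by blast
  ultimately show ?thesis using small by blast
qed

theorem existentially_closed_any:
  fixes H :: "'a heyting" and E :: "'b heyting"
  assumes "existentially_closed H" "heyting_algebra E" "embedding e H E"
    "set as \<subseteq> carrier H" "qf_vars \<theta> \<subseteq> {..<length as + m}"
    "existential_true E \<theta> m (map e as)"
  shows "existential_true H \<theta> m as"
proof -
  interpret E: heyting_algebra E by fact
  let ?U = "UNIV :: ('a + nat) set"
  have inf: "infinite ?U"
    by (metis finite_Plus_UNIV_iff infinite_UNIV_nat)
  obtain bs where bs: "length bs = m" "set bs \<subseteq> carrier E"
      "sat E (\<lambda>i. (map e as @ bs) ! i) \<theta>"
    using assms(6) by (auto simp: existential_true_def)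
  have eH: "e ` carrier H \<subseteq> carrier E"
    using assms(3) by (auto simp: embedding_def heyting_hom_def)
  have "|UNIV :: 'a set| \<le>o |?U|"
    unfolding card_of_ordLeq[symmetric] by (rule exI[of _ Inl]) auto
  then have "|e ` carrier H| \<le>o |?U|"
    by (meson card_of_image card_of_mono1 ordLeq_transitive subset_UNIV)
  moreover have "|set bs| \<le>o |?U|"
    by (rule finite_small[OF _ inf]) simp
  ultimately have "|e ` carrier H \<union> set bs| \<le>o |?U|"
    using inf by (intro card_of_Un_ordLeq_infinite_Field)
      (simp_all add: Field_card_of card_of_card_order_on)
  then obtain S where S: "subalgebra S E" "e ` carrier H \<union> set bs \<subseteq> S" "|S| \<le>o |?U|"
    using small_subalgebra[OF assms(2) _ _ inf] eH bs(2) by (metis Un_least)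
  then obtain g :: "'b \<Rightarrow> 'a + nat" where g: "inj_on g S"
    unfolding card_of_ordLeq[symmetric] by blast
  let ?S = "sub E S"
  have hS: "heyting_algebra ?S" by (rule heyting_algebra_sub[OF assms(2) S(1)])
  have cS: "carrier ?S = S" by (simp add: sub_def)
  let ?E = "transport g ?S"
  have hE: "heyting_algebra ?E" and emb: "embedding g ?S ?E"
    using transport[OF hS] g by (auto simp: cS)
  have e1: "embedding e H ?S"
    using assms(3) S(2) by (auto simp: embedding_def heyting_hom_def sub_def)
  have e2: "embedding (g \<circ> e) H ?E"
    using e1 emb by (auto simp: embedding_def heyting_hom_def image_subset_iff
      intro!: comp_inj_on inj_on_subset[of g "carrier ?S"])
  let ?v = "\<lambda>i. (map e as @ bs) ! i"
  have v: "?v i \<in> carrier ?S" if "i \<in> qf_vars \<theta>" for i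
  proof -
    have "i < length (map e as @ bs)" using that assms(5) bs(1) by auto
    then have "?v i \<in> set (map e as @ bs)" by (rule nth_mem)
    also have "\<dots> \<subseteq> S" using S(2) assms(4) by auto
    finally show ?thesis by (simp add: cS)
  qed
  have "sat ?S ?v \<theta>" using bs(3) by (simp add: sat_sub)
  then have "sat ?E (\<lambda>i. g (?v i)) \<theta>"
    using sat_embedding[where v = ?v and \<theta> = \<theta>, OF emb hS v] by simp
  moreover have "g (?v i) = (map (g \<circ> e) as @ map g bs) ! i" if "i \<in> qf_vars \<theta>" for i
    using that assms(5) bs(1) by (auto simp: nth_append)
  ultimately have "sat ?E (\<lambda>i. (map (g \<circ> e) as @ map g bs) ! i) \<theta>"
    using sat_cong[of \<theta> "\<lambda>i. g (?v i)" "\<lambda>i. (map (g \<circ> e) as @ map g bs) ! i"] by simp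
  moreover have "set (map g bs) \<subseteq> carrier ?E"
    using S(2) by (auto simp: transport_def Let_def cS)
  ultimately have "existential_true ?E \<theta> m (map (g \<circ> e) as)"
    unfolding existential_true_def using bs(1) by (intro exI[of _ "map g bs"]) auto
  then show ?thesis
    using assms(1,4,5) hE e2 unfolding existentially_closed_def by blast
qed

end


section \<open>The algebra \<open>\<H>\<^sub>0\<close>\<close>

text \<open>Extensions are represented by embeddings. Since finite algebras are only considered up to
  isomorphism, they can be taken to be carried by sets of natural numbers.\<close>

type_synonym 'a extn = "nat heyting \<times> ('a \<Rightarrow> nat)"

fun minimal_extension :: "'a heyting \<Rightarrow> 'a extn \<Rightarrow> bool" where
  "minimal_extension A (B, e) \<longleftrightarrow>
     heyting_algebra B \<and> finite (carrier B) \<and> embedding e A B \<and> e ` carrier A \<noteq> carrier B \<and>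
     (\<forall>S. subalgebra S B \<and> e ` carrier A \<subseteq> S \<longrightarrow> S = e ` carrier A \<or> S = carrier B)"

fun isomorphic_over :: "'a heyting \<Rightarrow> 'a extn \<Rightarrow> 'a extn \<Rightarrow> bool" where
  "isomorphic_over A (B, e) (B', e') \<longleftrightarrow>
     (\<exists>f. isomorphism f B B' \<and> (\<forall>a\<in>carrier A. f (e a) = e' a))"

definition extension_representatives :: "'a heyting \<Rightarrow> 'a extn list \<Rightarrow> bool" where
  "extension_representatives A Bs \<longleftrightarrow>
     (\<forall>X\<in>set Bs. minimal_extension A X) \<and>
     (\<forall>X. minimal_extension A X \<longrightarrow> (\<exists>Y\<in>set Bs. isomorphic_over A X Y)) \<and>
     (\<forall>i<length Bs. \<forall>j<length Bs. i \<noteq> j \<longrightarrow> \<not> isomorphic_over A (Bs ! i) (Bs ! j))"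

text \<open>One step \<open>C \<mapsto> C'\<close> for the pair \<open>A\<close>, \<open>(B, e)\<close>: \<open>D\<close> contains \<open>C\<close> through \<open>c\<close> and a copy of \<open>B\<close>
  through \<open>b\<close>, in such a way that the two images of \<open>A\<close> agree.\<close>

fun adjoin :: "'a heyting \<Rightarrow> 'a set \<times> 'a extn \<Rightarrow> 'a set \<Rightarrow> 'a set \<Rightarrow> bool" where
  "adjoin H (A, B, e) C C' \<longleftrightarrow>
     (\<exists>(D :: nat heyting) c b \<phi>.
        heyting_algebra D \<and> finite (carrier D) \<and>
        embedding c (sub H C) D \<and> embedding b B D \<and> (\<forall>a\<in>A. b (e a) = c a) \<and>
        embedding \<phi> D H \<and> (\<forall>x\<in>C. \<phi> (c x) = x) \<and>
        C' = generated H (C \<union> \<phi> ` b ` carrier B))"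

fun adjoin_all :: "'a heyting \<Rightarrow> ('a set \<times> 'a extn) list \<Rightarrow> 'a set \<Rightarrow> 'a set \<Rightarrow> bool" where
  "adjoin_all H [] C C' \<longleftrightarrow> C' = C"
| "adjoin_all H (p # ps) C C' \<longleftrightarrow> (\<exists>C1. adjoin H p C C1 \<and> adjoin_all H ps C1 C')"

definition next_stage :: "'a heyting \<Rightarrow> nat \<Rightarrow> 'a set \<Rightarrow> 'a set \<Rightarrow> bool" where
  "next_stage H n C C' \<longleftrightarrow>
     (\<exists>ABs :: ('a set \<times> 'a extn list) list.
        distinct (map fst ABs) \<and>
        set (map fst ABs) =
          {A. subalgebra A (sub H C) \<and> card (join_irreducibles (sub H A)) \<le> n} \<and>
        (\<forall>(A, Bs)\<in>set ABs. extension_representatives (sub H A) Bs) \<and>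
        adjoin_all H (concat (map (\<lambda>(A, Bs). map (Pair A) Bs) ABs)) C C')"

text \<open>All choices made in the construction (enumerations, representatives, \<open>D\<close>, \<open>\<phi>\<close>) are
  left free, so this is a predicate on the chain \<open>(H\<^sub>n)\<^sub>n\<close>.\<close>

definition H0_chain :: "'a heyting \<Rightarrow> (nat \<Rightarrow> 'a set) \<Rightarrow> bool" where
  "H0_chain H Hs \<longleftrightarrow> Hs 0 = {falsum H, verum H} \<and> (\<forall>n. next_stage H n (Hs n) (Hs (Suc n)))"


section \<open>The index \<open>h\<^sub>l\<^sub>,\<^sub>d\<close>\<close>

text \<open>The variables \<open>p\<^sub>1, \<dots>, p\<^sub>l\<close> are \<open>Var 0, \<dots>, Var (l - 1)\<close>, and \<open>q\<close> is \<open>Var l\<close>; tuples are lists.\<close>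

definition tuples :: "'a heyting \<Rightarrow> nat \<Rightarrow> 'a list set" where
  "tuples A l = {as. length as = l \<and> set as \<subseteq> carrier A}"

definition Th :: "'a heyting \<Rightarrow> nat \<Rightarrow> 'a list \<Rightarrow> fm set" where
  "Th A n as = {\<phi>. vars \<phi> \<subseteq> {..<length as} \<and> degree \<phi> \<le> n \<and> eval A (\<lambda>i. as ! i) \<phi> = verum A}"

text \<open>A system \<open>t = 1 \<and> (\<And>k. s\<^sub>k \<noteq> 1)\<close> is the pair of \<open>t\<close> and the list of the \<open>s\<^sub>k\<close>.\<close>

definition systems :: "nat \<Rightarrow> nat \<Rightarrow> (fm \<times> fm list) set" where
  "systems l d = {(t, ss). \<forall>\<phi>\<in>insert t (set ss). vars \<phi> \<subseteq> {..<Suc l} \<and> degree \<phi> \<le> d}"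

fun solvable :: "'a heyting \<Rightarrow> fm \<times> fm list \<Rightarrow> 'a list \<Rightarrow> bool" where
  "solvable A (t, ss) as \<longleftrightarrow>
     (\<exists>b\<in>carrier A. eval A (\<lambda>i. (as @ [b]) ! i) t = verum A \<and>
        (\<forall>s\<in>set ss. eval A (\<lambda>i. (as @ [b]) ! i) s \<noteq> verum A))"

definition h_index :: "nat \<Rightarrow> nat \<Rightarrow> 'a heyting \<Rightarrow> enat" where
  "h_index l d A = Inf {enat n | n.
     \<forall>as\<in>tuples A l. \<forall>as'\<in>tuples A l. Th A n as = Th A n as' \<longrightarrow>
       (\<forall>S\<in>systems l d. solvable A S as \<longleftrightarrow> solvable A S as')}"


section \<open>The metric on prime spectra of free Heyting algebras\<close>

definition Es :: "nat set \<Rightarrow> fm set set set" where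
  "Es V = {x. prime_filter (free_heyting V) x}"

definition sim :: "nat set \<Rightarrow> nat \<Rightarrow> fm set set \<Rightarrow> fm set set \<Rightarrow> bool" where
  "sim V d x y \<longleftrightarrow> (\<forall>t. vars t \<subseteq> V \<and> degree t \<le> d \<longrightarrow> (cls t \<in> x \<longleftrightarrow> cls t \<in> y))"

definition two_pow_neg :: "enat \<Rightarrow> real" where
  "two_pow_neg n = (case n of enat k \<Rightarrow> 1 / 2 ^ k | \<infinity> \<Rightarrow> 0)"

text \<open>\<open>Inf {} = \<infinity>\<close> in type \<open>enat\<close>.\<close>

definition delta :: "nat set \<Rightarrow> fm set set \<Rightarrow> fm set set \<Rightarrow> real" where
  "delta V x y = two_pow_neg (Inf {enat d | d. \<not> sim V d x y})"

end

theory Submission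
  imports Defs
begin

text \<open>
  A prime filter \<open>x\<close> over \<open>y\<close> that agrees with \<open>x\<^sub>0\<close> up to degree \<open>d\<close> exists unless finitely many
  formulas of \<open>y\<close> and \<open>x\<^sub>0\<close> contradict each other. To rule this out, take finite models of \<open>y\<close> and
  \<open>x\<^sub>0\<close> that are exact up to a large degree. Every nontrivial finite Heyting algebra embeds into
  \<open>\<H>\<^sub>0\<close>, being reached from the two-element algebra by minimal extensions, so both models may be taken
  in \<open>\<H>\<^sub>0\<close>. There they have the same theory up to degree \<open>h\<^sub>l\<^sub>,\<^sub>d\<close>, so the system describing \<open>x\<^sub>0\<close> up to
  degree \<open>d\<close>, solvable over the model of \<open>x\<^sub>0\<close>, is solvable over that of \<open>y\<close>. A solution gives a
  valuation in \<open>\<H>\<^sub>0\<close>, where \<open>1\<close> need not be join-prime; adjoining a root below the dual of \<open>\<H>\<^sub>0\<close>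
  (the Kleene slash) makes it so without changing which of the relevant formulas hold.
\<close>

section \<open>Prime theories\<close>

text \<open>Filters of formulas in all variables, not of classes over a fixed \<open>V\<close>: a
  single such theory has a trace on \<open>{..<l}\<close> and on \<open>{..<Suc l}\<close>, so
  extending a prime filter amounts to finding one theory.\<close>

definition prime_theory :: "fm set \<Rightarrow> bool" where
  "prime_theory T \<longleftrightarrow> Tru \<in> T \<and> Fls \<notin> T \<and> (\<forall>\<phi>\<in>T. \<forall>\<psi>. \<phi> \<turnstile> \<psi> \<longrightarrow> \<psi> \<in> T) \<and>
     (\<forall>\<phi>\<in>T. \<forall>\<psi>\<in>T. Conj \<phi> \<psi> \<in> T) \<and> (\<forall>\<phi> \<psi>. Disj \<phi> \<psi> \<in> T \<longrightarrow> \<phi> \<in> T \<or> \<psi> \<in> T)"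

lemma prime_theoryD:
  assumes "prime_theory T"
  shows "Tru \<in> T" "Fls \<notin> T" "\<phi> \<in> T \<Longrightarrow> \<phi> \<turnstile> \<psi> \<Longrightarrow> \<psi> \<in> T"
    "\<phi> \<in> T \<Longrightarrow> \<psi> \<in> T \<Longrightarrow> Conj \<phi> \<psi> \<in> T" "Disj \<phi> \<psi> \<in> T \<Longrightarrow> \<phi> \<in> T \<or> \<psi> \<in> T"
  using assms unfolding prime_theory_def by blast+

lemma prime_theory_Conj: "prime_theory T \<Longrightarrow> Conj \<phi> \<psi> \<in> T \<longleftrightarrow> \<phi> \<in> T \<and> \<psi> \<in> T"
  by (meson derives.ConjE1 derives.ConjE2 prime_theoryD)

lemma prime_theory_Disj: "prime_theory T \<Longrightarrow> Disj \<phi> \<psi> \<in> T \<longleftrightarrow> \<phi> \<in> T \<or> \<psi> \<in> T"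
  by (meson derives.DisjI1 derives.DisjI2 prime_theoryD)

lemma prime_theory_mp:
  assumes "prime_theory T" "Imp \<phi> \<psi> \<in> T" "\<phi> \<in> T"
  shows "\<psi> \<in> T"
proof -
  have "Conj (Imp \<phi> \<psi>) \<phi> \<turnstile> \<psi>" by (intro derives.ImpE derives.refl)
  with assms show ?thesis by (meson prime_theoryD)
qed

text \<open>Distributivity is not a rule of \<open>derives\<close>; it follows from residuation,
  since \<open>DisjE\<close> applies once the context \<open>\<chi>\<close> has been moved into an
  implication.\<close>

lemma Conj_DisjE:
  assumes "Conj \<chi> \<phi> \<turnstile> \<theta>" "Conj \<chi> \<psi> \<turnstile> \<theta>"
  shows "Conj \<chi> (Disj \<phi> \<psi>) \<turnstile> \<theta>"
proof -
  have swap: "Conj \<alpha> \<beta> \<turnstile> Conj \<beta> \<alpha>" for \<alpha> \<beta>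
    by (intro derives.ConjI derives.ConjE1 derives.ConjE2)
  have "Disj \<phi> \<psi> \<turnstile> Imp \<chi> \<theta>"
    using assms by (intro derives.DisjE derives.ImpI) (blast intro: derives.cut swap)+
  then have "Conj (Disj \<phi> \<psi>) \<chi> \<turnstile> \<theta>" by (rule derives.ImpE)
  then show ?thesis by (blast intro: derives.cut swap)
qed

text \<open>The prime filter theorem, with \<open>\<Gamma>\<close> a base of a filter and
  \<open>\<Delta>\<close> a base of an ideal. Zorn's lemma gives a filter maximal among those
  containing \<open>\<Gamma>\<close> and missing \<open>\<Delta>\<close>; maximality makes it
  prime.\<close>

lemma prime_theory_separating:
  assumes "\<Gamma> \<noteq> {}" and \<Gamma>: "\<And>\<phi> \<psi>. \<phi> \<in> \<Gamma> \<Longrightarrow> \<psi> \<in> \<Gamma> \<Longrightarrow> \<exists>\<chi>\<in>\<Gamma>. \<chi> \<turnstile> Conj \<phi> \<psi>"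
    and "\<Delta> \<noteq> {}" and \<Delta>: "\<And>\<phi> \<psi>. \<phi> \<in> \<Delta> \<Longrightarrow> \<psi> \<in> \<Delta> \<Longrightarrow> \<exists>\<chi>\<in>\<Delta>. Disj \<phi> \<psi> \<turnstile> \<chi>"
    and sep: "\<And>\<phi> \<psi>. \<phi> \<in> \<Gamma> \<Longrightarrow> \<psi> \<in> \<Delta> \<Longrightarrow> \<not> \<phi> \<turnstile> \<psi>"
  obtains T where "prime_theory T" "\<Gamma> \<subseteq> T" "T \<inter> \<Delta> = {}"
proof -
  define \<F> where "\<F> = {T. \<Gamma> \<subseteq> T \<and> (\<forall>\<phi>\<in>T. \<forall>\<psi>. \<phi> \<turnstile> \<psi> \<longrightarrow> \<psi> \<in> T) \<and>
     (\<forall>\<phi>\<in>T. \<forall>\<psi>\<in>T. Conj \<phi> \<psi> \<in> T) \<and> T \<inter> \<Delta> = {}}"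
  \<comment> \<open>The filter generated by \<open>\<Gamma>\<close> shows that \<open>\<F>\<close>
    is nonempty.\<close>
  have "{\<chi>. \<exists>\<gamma>\<in>\<Gamma>. \<gamma> \<turnstile> \<chi>} \<in> \<F>"
    unfolding \<F>_def
  proof (intro CollectI conjI ballI allI impI)
    fix \<phi> \<psi> assume "\<phi> \<in> {\<chi>. \<exists>\<gamma>\<in>\<Gamma>. \<gamma> \<turnstile> \<chi>}" "\<psi> \<in> {\<chi>. \<exists>\<gamma>\<in>\<Gamma>. \<gamma> \<turnstile> \<chi>}"
    then obtain \<gamma> \<gamma>' where "\<gamma> \<in> \<Gamma>" "\<gamma>' \<in> \<Gamma>" "\<gamma> \<turnstile> \<phi>" "\<gamma>' \<turnstile> \<psi>" by blast
    then show "\<exists>\<gamma>\<in>\<Gamma>. \<gamma> \<turnstile> Conj \<phi> \<psi>"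
      using \<Gamma>[of \<gamma> \<gamma>'] Conj_mono derives.cut by blast
  qed (use sep derives.refl derives.cut in blast)+
  moreover have "\<Union>\<C> \<in> \<F>" if \<C>: "\<C> \<noteq> {}" "subset.chain \<F> \<C>" for \<C>
    unfolding \<F>_def
  proof (intro CollectI conjI ballI allI impI)
    have "\<C> \<subseteq> \<F>" using \<C>(2) by (simp add: subset.chain_def)
    then have "\<forall>T\<in>\<C>. \<Gamma> \<subseteq> T \<and> T \<inter> \<Delta> = {}" unfolding \<F>_def by blast
    then show "\<Gamma> \<subseteq> \<Union>\<C>" "\<Union>\<C> \<inter> \<Delta> = {}" using \<C>(1) by blast+
    show "\<psi> \<in> \<Union>\<C>" if "\<phi> \<in> \<Union>\<C>" "\<phi> \<turnstile> \<psi>" for \<phi> \<psi>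
      using that \<open>\<C> \<subseteq> \<F>\<close> unfolding \<F>_def by blast
    fix \<phi> \<psi> assume "\<phi> \<in> \<Union>\<C>" "\<psi> \<in> \<Union>\<C>"
    then obtain S T where ST: "S \<in> \<C>" "T \<in> \<C>" "\<phi> \<in> S" "\<psi> \<in> T" by blast
    then have "S \<subseteq> T \<or> T \<subseteq> S"
      using \<C>(2) by (auto simp: subset.chain_def)
    then obtain U where "U \<in> \<C>" "\<phi> \<in> U" "\<psi> \<in> U" using ST by blast
    then show "Conj \<phi> \<psi> \<in> \<Union>\<C>"
      using \<open>\<C> \<subseteq> \<F>\<close> unfolding \<F>_def by blast
  qed
  ultimately obtain M where M: "M \<in> \<F>" and max: "\<And>X. X \<in> \<F> \<Longrightarrow> M \<subseteq> X \<Longrightarrow> X = M"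
    using subset_Zorn_nonempty[of \<F>] by blast
  have up: "\<psi> \<in> M" if "\<phi> \<in> M" "\<phi> \<turnstile> \<psi>" for \<phi> \<psi> using M that unfolding \<F>_def by blast
  have conj: "Conj \<phi> \<psi> \<in> M" if "\<phi> \<in> M" "\<psi> \<in> M" for \<phi> \<psi>
    using M that unfolding \<F>_def by blast
  have M\<Gamma>: "\<Gamma> \<subseteq> M" and M\<Delta>: "M \<inter> \<Delta> = {}" using M unfolding \<F>_def by blast+
  \<comment> \<open>This is what maximality says: the filter generated by \<open>M\<close> and a
    formula outside \<open>M\<close> must meet \<open>\<Delta>\<close>.\<close>
  have adjoin: "\<exists>\<mu>\<in>M. \<exists>\<delta>\<in>\<Delta>. Conj \<mu> \<phi> \<turnstile> \<delta>" if "\<phi> \<notin> M" for \<phi>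
  proof (rule ccontr)
    assume no: "\<not> (\<exists>\<mu>\<in>M. \<exists>\<delta>\<in>\<Delta>. Conj \<mu> \<phi> \<turnstile> \<delta>)"
    let ?N = "{\<chi>. \<exists>\<mu>\<in>M. Conj \<mu> \<phi> \<turnstile> \<chi>}"
    have MN: "M \<subseteq> ?N" using derives.ConjE1 by blast
    have "?N \<in> \<F>"
      unfolding \<F>_def
    proof (intro CollectI conjI ballI allI impI)
      fix \<psi> \<theta> assume "\<psi> \<in> ?N" "\<theta> \<in> ?N"
      then obtain \<mu> \<nu> where "\<mu> \<in> M" "\<nu> \<in> M" "Conj \<mu> \<phi> \<turnstile> \<psi>" "Conj \<nu> \<phi> \<turnstile> \<theta>" by blast
      moreover from this have "Conj (Conj \<mu> \<nu>) \<phi> \<turnstile> \<psi>" "Conj (Conj \<mu> \<nu>) \<phi> \<turnstile> \<theta>"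
        by (meson Conj_mono derives.ConjE1 derives.ConjE2 derives.cut derives.refl)+
      ultimately show "\<exists>\<mu>\<in>M. Conj \<mu> \<phi> \<turnstile> Conj \<psi> \<theta>"
        using conj derives.ConjI by blast
    qed (use M\<Gamma> MN no derives.cut in blast)+
    then have "?N = M" using MN by (rule max)
    moreover obtain \<mu> where "\<mu> \<in> M" using assms(1) M\<Gamma> by blast
    ultimately show False using that derives.ConjE2 by blast
  qed
  have "prime_theory M"
    unfolding prime_theory_def
  proof (intro conjI ballI allI impI)
    show "Tru \<in> M" using assms(1) M\<Gamma> up derives.TruI by blast
    show "Fls \<notin> M" using assms(3) M\<Delta> up derives.FlsE by blast
    fix \<phi> \<psi> assume disj: "Disj \<phi> \<psi> \<in> M"
    show "\<phi> \<in> M \<or> \<psi> \<in> M"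
    proof (rule ccontr)
      assume "\<not> (\<phi> \<in> M \<or> \<psi> \<in> M)"
      then obtain \<mu> \<delta> \<nu> \<epsilon> where *: "\<mu> \<in> M" "\<delta> \<in> \<Delta>" "Conj \<mu> \<phi> \<turnstile> \<delta>" "\<nu> \<in> M" "\<epsilon> \<in> \<Delta>" "Conj \<nu> \<psi> \<turnstile> \<epsilon>"
        using adjoin by metis
      \<comment> \<open>Directedness of \<open>\<Delta>\<close> merges the two obstructions into
        one, so the disjunction itself would put an element of \<open>\<Delta>\<close> into
        \<open>M\<close>.\<close>
      then obtain \<eta> where \<eta>: "\<eta> \<in> \<Delta>" "Disj \<delta> \<epsilon> \<turnstile> \<eta>" using \<Delta> by blast
      have "Conj (Conj \<mu> \<nu>) \<phi> \<turnstile> Conj \<mu> \<phi>" "Conj (Conj \<mu> \<nu>) \<psi> \<turnstile> Conj \<nu> \<psi>"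
        by (intro Conj_mono derives.refl derives.ConjE1 derives.ConjE2)+
      then have "Conj (Conj \<mu> \<nu>) (Disj \<phi> \<psi>) \<turnstile> \<eta>"
        using * \<eta>(2) by (intro Conj_DisjE) (meson derives.cut derives.DisjI1 derives.DisjI2)+
      then have "\<eta> \<in> M" using * conj disj up by blast
      then show False using \<eta> M\<Delta> by blast
    qed
  qed (use up conj in blast)+
  then show ?thesis using M\<Gamma> M\<Delta> that by blast
qed

lemma prime_theory_complete:
  assumes "\<not> \<phi> \<turnstile> \<psi>"
  obtains T where "prime_theory T" "\<phi> \<in> T" "\<psi> \<notin> T"
proof (rule prime_theory_separating[of "{\<phi>}" "{\<psi>}"])
  show "\<exists>\<chi>\<in>{\<phi>}. \<chi> \<turnstile> Conj \<alpha> \<beta>" if "\<alpha> \<in> {\<phi>}" "\<beta> \<in> {\<phi>}" for \<alpha> \<beta>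
    using that by (auto intro: derives.ConjI derives.refl)
  show "\<exists>\<chi>\<in>{\<psi>}. Disj \<alpha> \<beta> \<turnstile> \<chi>" if "\<alpha> \<in> {\<psi>}" "\<beta> \<in> {\<psi>}" for \<alpha> \<beta>
    using that by (auto intro: derives.DisjE derives.refl)
qed (use assms that in auto)

text \<open>The successor step of the canonical Kripke model. The formulas \<open>\<chi>\<close>
  with \<open>Imp \<alpha> \<chi> \<in> T\<close> form the filter generated by \<open>T\<close> and
  \<open>\<alpha>\<close>; it misses everything below \<open>\<beta>\<close> exactly because
  \<open>Imp \<alpha> \<beta> \<notin> T\<close>.\<close>

lemma prime_theory_Imp:
  assumes T: "prime_theory T" and "Imp \<alpha> \<beta> \<notin> T"
  obtains S where "prime_theory S" "T \<subseteq> S" "\<alpha> \<in> S" "\<beta> \<notin> S"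
proof -
  have gen: "Imp \<alpha> \<chi> \<in> T" if "\<theta> \<in> T" "Conj \<theta> \<alpha> \<turnstile> \<chi>" for \<theta> \<chi>
    using that T by (meson derives.ImpI prime_theoryD(3))
  have sub: "\<phi> \<in> T \<Longrightarrow> Imp \<alpha> \<phi> \<in> T" for \<phi>
    using gen derives.ConjE1 by blast
  have "Imp \<alpha> \<alpha> \<in> T" using prime_theoryD(1)[OF T] gen derives.ConjE2 by blast
  show thesis
  proof (rule prime_theory_separating[of "{\<chi>. Imp \<alpha> \<chi> \<in> T}" "{\<chi>. \<chi> \<turnstile> \<beta>}"])
    show "\<exists>\<chi>\<in>{\<chi>. Imp \<alpha> \<chi> \<in> T}. \<chi> \<turnstile> Conj \<phi> \<psi>"
      if "\<phi> \<in> {\<chi>. Imp \<alpha> \<chi> \<in> T}" "\<psi> \<in> {\<chi>. Imp \<alpha> \<chi> \<in> T}" for \<phi> \<psi>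
    proof -
      let ?\<theta> = "Conj (Imp \<alpha> \<phi>) (Imp \<alpha> \<psi>)"
      have "Conj (Imp \<alpha> \<chi>) \<alpha> \<turnstile> \<chi>" for \<chi> by (intro derives.ImpE derives.refl)
      then have "Conj ?\<theta> \<alpha> \<turnstile> \<phi>" "Conj ?\<theta> \<alpha> \<turnstile> \<psi>"
        by (meson Conj_mono derives.ConjE1 derives.ConjE2 derives.cut derives.refl)+
      moreover have "?\<theta> \<in> T" using that T by (simp add: prime_theoryD(4))
      ultimately have "Imp \<alpha> (Conj \<phi> \<psi>) \<in> T" using gen derives.ConjI by blast
      then show ?thesis using derives.refl by blast
    qed
    show "\<exists>\<chi>\<in>{\<chi>. \<chi> \<turnstile> \<beta>}. Disj \<phi> \<psi> \<turnstile> \<chi>" if "\<phi> \<in> {\<chi>. \<chi> \<turnstile> \<beta>}" "\<psi> \<in> {\<chi>. \<chi> \<turnstile> \<beta>}" for \<phi> \<psi>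
      using that by (auto intro: derives.DisjE derives.refl)
    show "\<not> \<phi> \<turnstile> \<psi>" if "\<phi> \<in> {\<chi>. Imp \<alpha> \<chi> \<in> T}" "\<psi> \<in> {\<chi>. \<chi> \<turnstile> \<beta>}" for \<phi> \<psi>
    proof
      assume "\<phi> \<turnstile> \<psi>"
      then have "Imp \<alpha> \<phi> \<turnstile> Imp \<alpha> \<beta>"
        using that by (blast intro: Imp_mono derives.refl derives.cut)
      then show False using that assms prime_theoryD(3) by blast
    qed
  qed (use \<open>Imp \<alpha> \<alpha> \<in> T\<close> sub that derives.refl in blast)+
qed

section \<open>Prime filters of free algebras as traces of prime theories\<close>

lemma Es_closed:
  assumes "x \<in> Es V"
  shows "cls Tru \<in> x" "cls Fls \<notin> x"
    "vars \<psi> \<subseteq> V \<Longrightarrow> cls \<phi> \<in> x \<Longrightarrow> \<phi> \<turnstile> \<psi> \<Longrightarrow> cls \<psi> \<in> x"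
    "cls \<phi> \<in> x \<Longrightarrow> cls \<psi> \<in> x \<Longrightarrow> cls (Conj \<phi> \<psi>) \<in> x"
    "vars \<phi> \<subseteq> V \<Longrightarrow> vars \<psi> \<subseteq> V \<Longrightarrow> cls (Disj \<phi> \<psi>) \<in> x \<Longrightarrow> cls \<phi> \<in> x \<or> cls \<psi> \<in> x"
proof -
  have x: "prime_filter (free_heyting V) x" using assms by (simp add: Es_def)
  show "cls Tru \<in> x" "cls Fls \<notin> x"
    using x by (auto simp: prime_filter_def free_heyting_simps)
  show "cls \<psi> \<in> x" if "vars \<psi> \<subseteq> V" "cls \<phi> \<in> x" "\<phi> \<turnstile> \<psi>"
    using x that unfolding prime_filter_def
    by (metis (no_types, lifting) free_heyting_le free_heyting_simps(1) imageI mem_Collect_eq)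
  show "cls (Conj \<phi> \<psi>) \<in> x" if "cls \<phi> \<in> x" "cls \<psi> \<in> x"
    using x that unfolding prime_filter_def by (metis free_heyting_simps(2))
  show "cls \<phi> \<in> x \<or> cls \<psi> \<in> x"
    if "vars \<phi> \<subseteq> V" "vars \<psi> \<subseteq> V" "cls (Disj \<phi> \<psi>) \<in> x"
  proof -
    have "cls \<phi> \<in> carrier (free_heyting V)" "cls \<psi> \<in> carrier (free_heyting V)"
      using that by (auto simp: free_heyting_simps)
    then show ?thesis
      using x that(3) unfolding prime_filter_def by (metis free_heyting_simps(3))
  qed
qed

lemma Es_mem: "x \<in> Es V \<Longrightarrow> X \<in> x \<Longrightarrow> \<exists>\<phi>. X = cls \<phi> \<and> vars \<phi> \<subseteq> V"
proof -
  assume "x \<in> Es V" "X \<in> x"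
  then have "X \<in> carrier (free_heyting V)" unfolding Es_def prime_filter_def by blast
  then show ?thesis unfolding free_heyting_simps(1) by blast
qed

definition spec :: "nat set \<Rightarrow> fm set \<Rightarrow> fm set set" where
  "spec V T = cls ` {\<phi> \<in> T. vars \<phi> \<subseteq> V}"

lemma cls_mem_spec:
  assumes "prime_theory T" "vars \<phi> \<subseteq> V"
  shows "cls \<phi> \<in> spec V T \<longleftrightarrow> \<phi> \<in> T"
  using assms(2) unfolding spec_def
  by (auto simp: cls_eq_iff intro: prime_theoryD(3)[OF assms(1)])

lemma spec_Es:
  assumes T: "prime_theory T"
  shows "spec V T \<in> Es V"
  unfolding Es_def prime_filter_def
proof (intro CollectI conjI ballI impI)
  show "spec V T \<subseteq> carrier (free_heyting V)"
    by (auto simp: spec_def free_heyting_simps)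
  show "verum (free_heyting V) \<in> spec V T" "falsum (free_heyting V) \<notin> spec V T"
    using T by (simp_all add: free_heyting_simps cls_mem_spec prime_theoryD)
next
  fix X Y assume "X \<in> spec V T" "Y \<in> spec V T"
  then show "meet (free_heyting V) X Y \<in> spec V T"
    using prime_theoryD(4)[OF T] by (force simp: spec_def free_heyting_simps)
next
  fix X Y assume "X \<in> spec V T" "Y \<in> carrier (free_heyting V)" "le (free_heyting V) X Y"
  then show "Y \<in> spec V T"
    using prime_theoryD(3)[OF T] by (force simp: spec_def free_heyting_simps free_heyting_le)
next
  fix X Y assume "X \<in> carrier (free_heyting V)" "Y \<in> carrier (free_heyting V)"
    "join (free_heyting V) X Y \<in> spec V T"
  then show "X \<in> spec V T \<or> Y \<in> spec V T"
    by (auto simp: free_heyting_simps cls_mem_spec[OF T] prime_theory_Disj[OF T])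
qed

text \<open>Separation with \<open>\<Gamma>\<close> the members of \<open>y\<close> strengthened by
  \<open>\<tau>\<close> and \<open>\<Delta>\<close> the nonmembers of \<open>y\<close> weakened by
  \<open>\<sigma>\<close>; primeness of \<open>y\<close> makes \<open>\<Delta>\<close> directed. As
  \<open>\<tau>\<close> and \<open>\<sigma>\<close> may contain variables outside \<open>V\<close>,
  this extends \<open>y\<close> to new variables under constraints.\<close>

lemma Es_prime_theory_separating:
  assumes y: "y \<in> Es V"
    and sep: "\<And>\<alpha> \<beta>. vars \<alpha> \<subseteq> V \<Longrightarrow> vars \<beta> \<subseteq> V \<Longrightarrow> cls \<alpha> \<in> y \<Longrightarrow> cls \<beta> \<notin> y \<Longrightarrow>
      \<not> Conj \<alpha> \<tau> \<turnstile> Disj \<beta> \<sigma>"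
  obtains T where "prime_theory T" "spec V T = y" "\<tau> \<in> T" "\<sigma> \<notin> T"
proof -
  let ?\<Gamma> = "{Conj \<alpha> \<tau> |\<alpha>. vars \<alpha> \<subseteq> V \<and> cls \<alpha> \<in> y}"
  let ?\<Delta> = "{Disj \<beta> \<sigma> |\<beta>. vars \<beta> \<subseteq> V \<and> cls \<beta> \<notin> y}"
  \<comment> \<open>These two elements make both families nonempty and are equivalent to
    \<open>\<tau>\<close> and \<open>\<sigma>\<close>, which gives the last two claims.\<close>
  have T0: "Conj Tru \<tau> \<in> ?\<Gamma>" "Disj Fls \<sigma> \<in> ?\<Delta>" using Es_closed(1,2)[OF y] by auto
  obtain T where T: "prime_theory T" "?\<Gamma> \<subseteq> T" "T \<inter> ?\<Delta> = {}"
  proof (rule prime_theory_separating[of ?\<Gamma> ?\<Delta>])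
    fix \<phi> \<psi> assume "\<phi> \<in> ?\<Gamma>" "\<psi> \<in> ?\<Gamma>"
    then obtain \<alpha> \<alpha>' where *: "\<phi> = Conj \<alpha> \<tau>" "\<psi> = Conj \<alpha>' \<tau>" "vars \<alpha> \<subseteq> V" "vars \<alpha>' \<subseteq> V"
      "cls \<alpha> \<in> y" "cls \<alpha>' \<in> y" by blast
    then have "Conj (Conj \<alpha> \<alpha>') \<tau> \<in> ?\<Gamma>" using Es_closed(4)[OF y] by auto
    moreover have "Conj (Conj \<alpha> \<alpha>') \<tau> \<turnstile> Conj \<phi> \<psi>"
      unfolding * by (intro derives.ConjI Conj_mono derives.refl derives.ConjE1 derives.ConjE2)
    ultimately show "\<exists>\<chi>\<in>?\<Gamma>. \<chi> \<turnstile> Conj \<phi> \<psi>" by blast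
  next
    fix \<phi> \<psi> assume "\<phi> \<in> ?\<Delta>" "\<psi> \<in> ?\<Delta>"
    then obtain \<beta> \<beta>' where *: "\<phi> = Disj \<beta> \<sigma>" "\<psi> = Disj \<beta>' \<sigma>" "vars \<beta> \<subseteq> V" "vars \<beta>' \<subseteq> V"
      "cls \<beta> \<notin> y" "cls \<beta>' \<notin> y" by blast
    then have "Disj (Disj \<beta> \<beta>') \<sigma> \<in> ?\<Delta>" using Es_closed(5)[OF y] by auto
    moreover have "Disj \<phi> \<psi> \<turnstile> Disj (Disj \<beta> \<beta>') \<sigma>"
      unfolding * by (intro derives.DisjE Disj_mono derives.refl derives.DisjI1 derives.DisjI2)
    ultimately show "\<exists>\<chi>\<in>?\<Delta>. Disj \<phi> \<psi> \<turnstile> \<chi>" by blast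
  qed (use sep T0 in blast)+
  have "Conj Tru \<tau> \<in> T" "Disj Fls \<sigma> \<notin> T" using T(2,3) T0 by blast+
  then have "\<tau> \<in> T" "\<sigma> \<notin> T"
    using T(1) by (simp_all add: prime_theory_Conj prime_theory_Disj)
  moreover have "cls \<phi> \<in> y \<longleftrightarrow> \<phi> \<in> T" if "vars \<phi> \<subseteq> V" for \<phi>
  proof
    assume "cls \<phi> \<in> y"
    then have "Conj \<phi> \<tau> \<in> T" using that T(2) by blast
    then show "\<phi> \<in> T" using T(1) by (simp add: prime_theory_Conj)
  next
    assume "\<phi> \<in> T"
    then have "Disj \<phi> \<sigma> \<in> T" using T(1) by (simp add: prime_theory_Disj)
    then show "cls \<phi> \<in> y" using that T(3) by blast
  qed
  then have "spec V T = y"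
    using Es_mem[OF y] unfolding spec_def by blast
  ultimately show thesis using T(1) that by blast
qed

text \<open>The case without constraints: \<open>Tru\<close> and \<open>Fls\<close> restrict
  nothing.\<close>

lemma Es_eq_spec:
  assumes y: "y \<in> Es V"
  obtains T where "prime_theory T" "y = spec V T"
proof (rule Es_prime_theory_separating[OF y, of Tru Fls])
  fix \<alpha> \<beta> assume *: "vars \<alpha> \<subseteq> V" "vars \<beta> \<subseteq> V" "cls \<alpha> \<in> y" "cls \<beta> \<notin> y"
  show "\<not> Conj \<alpha> Tru \<turnstile> Disj \<beta> Fls"
  proof
    assume "Conj \<alpha> Tru \<turnstile> Disj \<beta> Fls"
    then have "\<alpha> \<turnstile> \<beta>"
      by (meson derives.ConjI derives.DisjE derives.FlsE derives.TruI derives.cut derives.refl)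
    then show False using * Es_closed(3)[OF y] by blast
  qed
qed (use that in blast)

section \<open>Finitely many formulas of bounded degree\<close>

text \<open>The combinations of generators without a new implication. Formulas of degree at most
  \<open>Suc d\<close> are of this kind over the variables and the implications between formulas of
  degree at most \<open>d\<close>.\<close>

inductive_set lattice_closure :: "fm set \<Rightarrow> fm set" for G where
  gen: "\<phi> \<in> G \<Longrightarrow> \<phi> \<in> lattice_closure G"
| Fls: "Fls \<in> lattice_closure G"
| Tru: "Tru \<in> lattice_closure G"
| Conj: "\<phi> \<in> lattice_closure G \<Longrightarrow> \<psi> \<in> lattice_closure G \<Longrightarrow> Conj \<phi> \<psi> \<in> lattice_closure G"
| Disj: "\<phi> \<in> lattice_closure G \<Longrightarrow> \<psi> \<in> lattice_closure G \<Longrightarrow> Disj \<phi> \<psi> \<in> lattice_closure G"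

lemma finite_lattice_closure:
  assumes "finite (cls ` G)"
  shows "finite (cls ` lattice_closure G)"
proof -
  text \<open>A formula is determined up to equivalence by the prime theories containing it, and
    membership in a prime theory is determined by the generators it contains.\<close>
  define key where "key \<phi> = {cls ` (G \<inter> T) |T. prime_theory T \<and> \<phi> \<in> T}" for \<phi>
  have agree: "\<phi> \<in> S \<longleftrightarrow> \<phi> \<in> T"
    if "prime_theory S" "prime_theory T" "cls ` (G \<inter> S) = cls ` (G \<inter> T)"
      "\<phi> \<in> lattice_closure G" for S T \<phi>
    using that(4)
  proof induction
    case (gen \<phi>)
    have "\<phi> \<in> U'" if "cls ` (G \<inter> U) = cls ` (G \<inter> U')" "prime_theory U'" "\<phi> \<in> U" for U U'
    proof -
      have "cls \<phi> \<in> cls ` (G \<inter> U')" using gen that by blast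
      then show ?thesis using that(2) by (auto simp: cls_eq_iff intro: prime_theoryD(3))
    qed
    then show ?case using that by metis
  qed (use that in \<open>auto simp: prime_theoryD prime_theory_Conj prime_theory_Disj\<close>)
  have imp: "\<phi> \<turnstile> \<psi>" if "\<phi> \<in> lattice_closure G" "\<psi> \<in> lattice_closure G" "key \<phi> = key \<psi>" for \<phi> \<psi>
  proof (rule ccontr)
    assume "\<not> \<phi> \<turnstile> \<psi>"
    then obtain T where T: "prime_theory T" "\<phi> \<in> T" "\<psi> \<notin> T" by (rule prime_theory_complete)
    then have "cls ` (G \<inter> T) \<in> key \<phi>" unfolding key_def by blast
    then have "cls ` (G \<inter> T) \<in> key \<psi>" unfolding that(3) .
    then obtain S where "prime_theory S" "\<psi> \<in> S" "cls ` (G \<inter> T) = cls ` (G \<inter> S)"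
      unfolding key_def by blast
    then show False using T agree[OF T(1) _ _ that(2)] by blast
  qed
  have "finite (key ` lattice_closure G)"
    by (rule finite_subset[of _ "Pow (Pow (cls ` G))"]) (use assms in \<open>auto simp: key_def\<close>)
  moreover have "cls ` lattice_closure G \<subseteq>
      (\<lambda>k. cls (SOME \<phi>. \<phi> \<in> lattice_closure G \<and> key \<phi> = k)) ` key ` lattice_closure G"
  proof
    fix X assume "X \<in> cls ` lattice_closure G"
    then obtain \<phi> where \<phi>: "X = cls \<phi>" "\<phi> \<in> lattice_closure G" by blast
    let ?\<psi> = "SOME \<psi>. \<psi> \<in> lattice_closure G \<and> key \<psi> = key \<phi>"
    have "?\<psi> \<in> lattice_closure G \<and> key ?\<psi> = key \<phi>"
      by (rule someI[of _ \<phi>]) (use \<phi> in simp)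
    then have \<psi>: "?\<psi> \<in> lattice_closure G" "key ?\<psi> = key \<phi>" by (rule conjunct1, rule conjunct2)
    have "X = cls ?\<psi>"
      unfolding \<phi>(1) cls_eq_iff by (intro conjI imp \<phi>(2) \<psi> \<psi>(2)[symmetric])
    then show "X \<in> (\<lambda>k. cls (SOME \<phi>. \<phi> \<in> lattice_closure G \<and> key \<phi> = k)) ` key ` lattice_closure G"
      using \<phi>(2) by blast
  qed
  ultimately show ?thesis by (meson finite_imageI finite_subset)
qed

abbreviation bounded_fms :: "nat set \<Rightarrow> nat \<Rightarrow> fm set" where
  "bounded_fms V d \<equiv> {\<phi>. vars \<phi> \<subseteq> V \<and> degree \<phi> \<le> d}"

lemma finite_cls_bounded_fms:
  assumes "finite V"
  shows "finite (cls ` bounded_fms V d)"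
proof (induction d)
  case 0
  have "\<phi> \<in> lattice_closure (Var ` V)" if "\<phi> \<in> bounded_fms V 0" for \<phi>
    using that by (induction \<phi>) (auto intro: lattice_closure.intros)
  then show ?case
    using finite_lattice_closure[of "Var ` V"] assms
    by (meson finite_imageI finite_subset image_mono subsetI)
next
  case (Suc d)
  let ?B = "bounded_fms V d"
  let ?G = "Var ` V \<union> {Imp \<alpha> \<beta> |\<alpha> \<beta>. \<alpha> \<in> ?B \<and> \<beta> \<in> ?B}"
  have "\<phi> \<in> lattice_closure ?G" if "\<phi> \<in> bounded_fms V (Suc d)" for \<phi>
    using that by (induction \<phi>) (auto intro: lattice_closure.intros)
  \<comment> \<open>There are infinitely many implications in \<open>?G\<close>, but the class of
    each depends only on the classes of its two sides, of which there are finitely many by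
    induction.\<close>
  moreover have "cls ` ?G \<subseteq> cls ` Var ` V \<union>
      (\<lambda>(X, Y). imp (free_heyting V) X Y) ` (cls ` ?B \<times> cls ` ?B)"
    by (force simp: free_heyting_simps(4)[of V, symmetric])
  then have "finite (cls ` ?G)"
    by (rule finite_subset) (use assms Suc in auto)
  ultimately show ?case
    using finite_lattice_closure[of ?G] by (meson finite_subset image_mono subsetI)
qed

section \<open>Finite models\<close>

text \<open>The algebra of a Kripke frame: a valuation in it is a Kripke model on \<open>W\<close>,
  and \<open>eval\<close> yields the set of worlds forcing a formula.\<close>

definition upset_algebra :: "'p::order set \<Rightarrow> 'p set heyting" where
  "upset_algebra W =
     \<lparr>carrier = {U. U \<subseteq> W \<and> (\<forall>u\<in>U. \<forall>w\<in>W. u \<le> w \<longrightarrow> w \<in> U)},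
      meet = (\<inter>), join = (\<union>),
      imp = (\<lambda>U U'. {u \<in> W. \<forall>w\<in>W. u \<le> w \<and> w \<in> U \<longrightarrow> w \<in> U'}),
      falsum = {}, verum = W\<rparr>"

lemma heyting_algebra_upset: "heyting_algebra (upset_algebra W)"
proof
  fix a b c assume "a \<in> carrier (upset_algebra W)" "b \<in> carrier (upset_algebra W)"
    "c \<in> carrier (upset_algebra W)"
  then have W: "a \<subseteq> W" and up: "\<And>u w. u \<in> a \<Longrightarrow> w \<in> W \<Longrightarrow> u \<le> w \<Longrightarrow> w \<in> a"
    by (auto simp: upset_algebra_def)
  have "a \<inter> b \<subseteq> c \<longleftrightarrow> a \<subseteq> {u \<in> W. \<forall>w\<in>W. u \<le> w \<and> w \<in> b \<longrightarrow> w \<in> c}"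
  proof
    assume "a \<inter> b \<subseteq> c"
    then show "a \<subseteq> {u \<in> W. \<forall>w\<in>W. u \<le> w \<and> w \<in> b \<longrightarrow> w \<in> c}" using W up by blast
  next
    assume *: "a \<subseteq> {u \<in> W. \<forall>w\<in>W. u \<le> w \<and> w \<in> b \<longrightarrow> w \<in> c}"
    show "a \<inter> b \<subseteq> c"
    proof
      fix u assume "u \<in> a \<inter> b"
      then show "u \<in> c" using * W order_refl[of u] by blast
    qed
  qed
  then show "le (upset_algebra W) (meet (upset_algebra W) a b) c \<longleftrightarrow>
      le (upset_algebra W) a (imp (upset_algebra W) b c)"
    unfolding le_def upset_algebra_def by (simp add: inf.absorb_iff1)
qed (auto simp: upset_algebra_def le_def intro: order_trans)

text \<open>A finite quotient of the canonical model above \<open>T\<close>: worlds are traces of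
  prime theories on the formulas of degree at most \<open>m\<close>, finitely many up to
  equivalence. The trace of \<open>T\<close> is a least world, so a formula has value
  \<open>1\<close> iff it is forced there.\<close>

lemma finite_model:
  assumes "finite V" "x \<in> Es V"
  obtains A :: "nat heyting" and v where
    "heyting_algebra A" "finite (carrier A)" "\<And>i. v i \<in> carrier A"
    "\<And>\<phi>. vars \<phi> \<subseteq> V \<Longrightarrow> degree \<phi> \<le> m \<Longrightarrow> eval A v \<phi> = verum A \<longleftrightarrow> cls \<phi> \<in> x"
proof -
  let ?B = "bounded_fms V m"
  obtain T where T: "prime_theory T" "x = spec V T" using assms(2) by (rule Es_eq_spec)
  define W where "W = {cls ` (S \<inter> ?B) |S. prime_theory S \<and> T \<subseteq> S}"
  have mem: "cls \<phi> \<in> cls ` (S \<inter> ?B) \<longleftrightarrow> \<phi> \<in> S" if "prime_theory S" "\<phi> \<in> ?B" for S \<phi>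
    using that by (auto simp: cls_eq_iff intro: prime_theoryD(3))
  have "finite W"
    by (rule finite_subset[of _ "Pow (cls ` ?B)"])
      (use finite_cls_bounded_fms[OF assms(1)] in \<open>auto simp: W_def\<close>)
  let ?U = "upset_algebra W"
  interpret U: heyting_algebra ?U by (rule heyting_algebra_upset)
  have finU: "finite (carrier ?U)"
    by (rule finite_subset[of _ "Pow W"]) (use \<open>finite W\<close> in \<open>auto simp: upset_algebra_def\<close>)
  define u where "u i = {w \<in> W. cls (Var i) \<in> w}" for i
  have u: "u i \<in> carrier ?U" for i by (auto simp: u_def upset_algebra_def)
  have truth: "eval ?U u \<phi> = {w \<in> W. cls \<phi> \<in> w}" if "\<phi> \<in> ?B" for \<phi>
    using that
  proof (induction \<phi>)
    case (Imp \<alpha> \<beta>)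
    then have B: "\<alpha> \<in> ?B" "\<beta> \<in> ?B" by auto
    \<comment> \<open>Inclusion of traces is weaker than inclusion of theories, but it suffices:
      \<open>Imp \<alpha> \<beta>\<close> lies in \<open>?B\<close> itself and so persists along
      inclusions, while the extension given by \<open>prime_theory_Imp\<close> does induce an
      inclusion of traces.\<close>
    have "(\<forall>w'\<in>W. w \<subseteq> w' \<and> cls \<alpha> \<in> w' \<longrightarrow> cls \<beta> \<in> w') \<longleftrightarrow> cls (Imp \<alpha> \<beta>) \<in> w"
      if w: "w \<in> W" for w
    proof (intro iffI ballI impI)
      obtain S where S: "prime_theory S" "T \<subseteq> S" "w = cls ` (S \<inter> ?B)"
        using w unfolding W_def by blast
      assume R: "\<forall>w'\<in>W. w \<subseteq> w' \<and> cls \<alpha> \<in> w' \<longrightarrow> cls \<beta> \<in> w'"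
      show "cls (Imp \<alpha> \<beta>) \<in> w"
      proof (rule ccontr)
        assume "cls (Imp \<alpha> \<beta>) \<notin> w"
        then have "Imp \<alpha> \<beta> \<notin> S" unfolding S(3) mem[OF S(1) Imp.prems] .
        with S(1) obtain S' where S': "prime_theory S'" "S \<subseteq> S'" "\<alpha> \<in> S'" "\<beta> \<notin> S'"
          by (rule prime_theory_Imp)
        have "cls ` (S' \<inter> ?B) \<in> W" using S' S(2) unfolding W_def by blast
        moreover have "w \<subseteq> cls ` (S' \<inter> ?B)" using S' unfolding S(3) by blast
        ultimately show False using R mem[OF S'(1) B(1)] mem[OF S'(1) B(2)] S' by blast
      qed
    next
      fix w' assume w': "cls (Imp \<alpha> \<beta>) \<in> w" "w' \<in> W" "w \<subseteq> w' \<and> cls \<alpha> \<in> w'"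
      obtain S where S: "prime_theory S" "w' = cls ` (S \<inter> ?B)"
        using w'(2) unfolding W_def by blast
      have "cls (Imp \<alpha> \<beta>) \<in> w'" "cls \<alpha> \<in> w'" using w' by blast+
      then have "Imp \<alpha> \<beta> \<in> S" "\<alpha> \<in> S"
        unfolding S(2) mem[OF S(1) Imp.prems] mem[OF S(1) B(1)] .
      then have "\<beta> \<in> S" using S(1) prime_theory_mp by blast
      then show "cls \<beta> \<in> w'" unfolding S(2) mem[OF S(1) B(2)] .
    qed
    then show ?case
      using Imp.IH B by (auto simp: upset_algebra_def)
  next
    case (Conj \<alpha> \<beta>)
    then have B: "\<alpha> \<in> ?B" "\<beta> \<in> ?B" by auto
    have "cls (Conj \<alpha> \<beta>) \<in> w \<longleftrightarrow> cls \<alpha> \<in> w \<and> cls \<beta> \<in> w" if w: "w \<in> W" for w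
    proof -
      obtain S where S: "prime_theory S" "w = cls ` (S \<inter> ?B)" using w unfolding W_def by blast
      show ?thesis
        unfolding S(2) mem[OF S(1) Conj.prems] mem[OF S(1) B(1)] mem[OF S(1) B(2)]
        by (rule prime_theory_Conj[OF S(1)])
    qed
    then show ?case using Conj.IH B by (auto simp: upset_algebra_def)
  next
    case (Disj \<alpha> \<beta>)
    then have B: "\<alpha> \<in> ?B" "\<beta> \<in> ?B" by auto
    have "cls (Disj \<alpha> \<beta>) \<in> w \<longleftrightarrow> cls \<alpha> \<in> w \<or> cls \<beta> \<in> w" if w: "w \<in> W" for w
    proof -
      obtain S where S: "prime_theory S" "w = cls ` (S \<inter> ?B)" using w unfolding W_def by blast
      show ?thesis
        unfolding S(2) mem[OF S(1) Disj.prems] mem[OF S(1) B(1)] mem[OF S(1) B(2)]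
        by (rule prime_theory_Disj[OF S(1)])
    qed
    then show ?case using Disj.IH B by (auto simp: upset_algebra_def)
  next
    case Fls
    then show ?case using mem[OF _ Fls] by (auto simp: upset_algebra_def W_def prime_theoryD(2))
  next
    case Tru
    then show ?case using mem[OF _ Tru] by (auto simp: upset_algebra_def W_def prime_theoryD(1))
  qed (auto simp: u_def)
  \<comment> \<open>The root: an upward closed set is all of \<open>W\<close> iff it contains
    \<open>r\<close>.\<close>
  define r where "r = cls ` (T \<inter> ?B)"
  have r: "r \<in> W" "\<And>w. w \<in> W \<Longrightarrow> r \<subseteq> w"
    using T(1) unfolding r_def W_def by blast+
  have root: "c = W \<longleftrightarrow> r \<in> c" if "c \<in> carrier ?U" for c
    using that r unfolding upset_algebra_def by auto
  have verum_iff: "eval ?U u \<phi> = verum ?U \<longleftrightarrow> cls \<phi> \<in> x" if "\<phi> \<in> ?B" for \<phi>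
  proof -
    have "eval ?U u \<phi> = W \<longleftrightarrow> r \<in> eval ?U u \<phi>" by (intro root U.eval_closed u)
    also have "\<dots> \<longleftrightarrow> \<phi> \<in> T"
      unfolding truth[OF that] using r(1) mem[OF T(1) that] by (simp add: r_def)
    also have "\<dots> \<longleftrightarrow> cls \<phi> \<in> x" using that T by (simp add: cls_mem_spec)
    finally show ?thesis by (simp add: upset_algebra_def)
  qed
  \<comment> \<open>The model is moved to a carrier of natural numbers, the type on which the
    construction of the chain takes its finite extensions.\<close>
  obtain g :: "_ \<Rightarrow> nat" where g: "inj_on g (carrier ?U)"
    using finite_imp_inj_to_nat_seg[OF finU] by blast
  let ?A = "transport g ?U"
  have hA: "heyting_algebra ?A" and emb: "embedding g ?U ?A"
    using transport[OF U.heyting_algebra_axioms g] by auto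
  have cA: "carrier ?A = g ` carrier ?U" by (simp add: transport_def Let_def)
  have gv: "g c = verum ?A \<longleftrightarrow> c = verum ?U" if "c \<in> carrier ?U" for c
    using emb that U.verum_closed g inj_onD unfolding embedding_def heyting_hom_def by metis
  show thesis
  proof (rule that[OF hA])
    show "finite (carrier ?A)" using finU by (simp add: cA)
    show "g (u i) \<in> carrier ?A" for i using u by (simp add: cA)
    show "eval ?A (\<lambda>i. g (u i)) \<phi> = verum ?A \<longleftrightarrow> cls \<phi> \<in> x"
      if "vars \<phi> \<subseteq> V" "degree \<phi> \<le> m" for \<phi>
    proof -
      have "eval ?A (\<lambda>i. g (u i)) \<phi> = g (eval ?U u \<phi>)"
        using emb U.heyting_algebra_axioms u by (intro eval_hom) (auto simp: embedding_def)
      then show ?thesis using that gv[OF U.eval_closed] u verum_iff by simp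
    qed
  qed
qed

section \<open>Finite algebras embed into the union of the chain\<close>

lemma subalgebra_generated:
  assumes "heyting_algebra H" "X \<subseteq> carrier H"
  shows "subalgebra (generated H X) H" "X \<subseteq> generated H X"
proof -
  interpret heyting_algebra H by fact
  have "subalgebra (carrier H) H"
    by (simp add: subalgebra_def meet_closed join_closed imp_closed falsum_closed verum_closed)
  then have "generated H X \<subseteq> carrier H"
    using assms(2) unfolding generated_def by blast
  moreover have "falsum H \<in> generated H X" "verum H \<in> generated H X"
    unfolding generated_def subalgebra_def by blast+
  moreover have "meet H a b \<in> generated H X \<and> join H a b \<in> generated H X \<and> imp H a b \<in> generated H X"
    if "a \<in> generated H X" "b \<in> generated H X" for a b
    using that unfolding generated_def subalgebra_def by blast
  ultimately show "subalgebra (generated H X) H" by (simp add: subalgebra_def)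
  show "X \<subseteq> generated H X" unfolding generated_def by blast
qed

lemma embedding_comp:
  assumes "embedding f A B" "embedding g B C"
  shows "embedding (g \<circ> f) A C"
proof -
  have "f ` carrier A \<subseteq> carrier B" using assms(1) by (simp add: embedding_def heyting_hom_def)
  then show ?thesis
    using assms by (auto simp: embedding_def heyting_hom_def image_subset_iff
      intro!: comp_inj_on inj_on_subset[of g "carrier B"])
qed

lemma adjoin_subalgebra:
  assumes "heyting_algebra H" "subalgebra C H" "adjoin H (A, B, e) C C'"
  shows "subalgebra C' H" "C \<subseteq> C'" "\<exists>f. embedding f B H \<and> f ` carrier B \<subseteq> C'"
proof -
  obtain D :: "nat heyting" and b \<phi> where D: "embedding b B D" "embedding \<phi> D H"
      "C' = generated H (C \<union> \<phi> ` b ` carrier B)"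
    using assms(3) by auto
  from D(1,2) have emb: "embedding (\<phi> \<circ> b) B H" by (rule embedding_comp)
  then have "(\<phi> \<circ> b) ` carrier B \<subseteq> carrier H" unfolding embedding_def heyting_hom_def by blast
  then have "C \<union> \<phi> ` b ` carrier B \<subseteq> carrier H"
    using assms(2) by (auto simp: subalgebra_def)
  note gen = subalgebra_generated[OF assms(1) this]
  show "subalgebra C' H" "C \<subseteq> C'" using gen D(3) by auto
  have "(\<phi> \<circ> b) ` carrier B \<subseteq> C'" using gen(2) D(3) by auto
  with emb show "\<exists>f. embedding f B H \<and> f ` carrier B \<subseteq> C'" by blast
qed

lemma adjoin_all_subalgebra:
  assumes "heyting_algebra H" "subalgebra C H" "adjoin_all H ps C C'"
  shows "subalgebra C' H \<and> C \<subseteq> C' \<and>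
    (\<forall>(A, B, e)\<in>set ps. \<exists>f. embedding f B H \<and> f ` carrier B \<subseteq> C')"
  using assms(2,3)
proof (induction ps arbitrary: C)
  case (Cons p ps)
  obtain A B e where p: "p = (A, B, e)" by (cases p)
  then obtain C1 where C1: "adjoin H (A, B, e) C C1" "adjoin_all H ps C1 C'"
    using Cons.prems(2) unfolding adjoin_all.simps by blast
  note step = adjoin_subalgebra[OF assms(1) Cons.prems(1) C1(1)]
  have IH: "subalgebra C' H \<and> C1 \<subseteq> C' \<and>
      (\<forall>(A, B, e)\<in>set ps. \<exists>f. embedding f B H \<and> f ` carrier B \<subseteq> C')"
    using Cons.IH[OF step(1) C1(2)] .
  obtain f where "embedding f B H" "f ` carrier B \<subseteq> C1" using step(3) by blast
  then have "\<exists>f. embedding f B H \<and> f ` carrier B \<subseteq> C'" using IH by blast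
  then show ?case using IH step(2) by (auto simp: p)
qed simp

lemma heyting_hom_subalgebra_image:
  assumes "heyting_hom f A B" "subalgebra S A"
  shows "subalgebra (f ` S) B"
proof -
  have S: "a \<in> carrier A" if "a \<in> S" for a using that assms(2) by (auto simp: subalgebra_def)
  have "meet B (f a) (f b) \<in> f ` S \<and> join B (f a) (f b) \<in> f ` S \<and> imp B (f a) (f b) \<in> f ` S"
    if "a \<in> S" "b \<in> S" for a b
  proof -
    have "f (meet A a b) = meet B (f a) (f b)" "f (join A a b) = join B (f a) (f b)"
      "f (imp A a b) = imp B (f a) (f b)"
      using assms(1) S that by (auto simp: heyting_hom_def)
    moreover have "meet A a b \<in> S" "join A a b \<in> S" "imp A a b \<in> S"
      using assms(2) that by (auto simp: subalgebra_def)
    ultimately show ?thesis by (metis imageI)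
  qed
  moreover have "falsum B \<in> f ` S" "verum B \<in> f ` S"
    using assms unfolding heyting_hom_def subalgebra_def by (metis imageI)+
  moreover have "f ` S \<subseteq> carrier B" using assms(1) S by (auto simp: heyting_hom_def)
  ultimately show ?thesis unfolding subalgebra_def by blast
qed

lemma isomorphism_imp_embedding: "isomorphism f A B \<Longrightarrow> embedding f A B"
  by (simp add: isomorphism_def embedding_def bij_betw_def)

lemma embedding_inv_into:
  assumes "heyting_algebra A" "embedding f A B"
  shows "embedding (inv_into (carrier A) f) (sub B (f ` carrier A)) A"
proof -
  interpret heyting_algebra A by fact
  have f: "inj_on f (carrier A)" "heyting_hom f A B" using assms(2) by (auto simp: embedding_def)
  let ?g = "inv_into (carrier A) f"
  have g: "?g (f a) = a" if "a \<in> carrier A" for a using f(1) that by simp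
  have "?g (meet B (f a) (f b)) = meet A a b" "?g (join B (f a) (f b)) = join A a b"
    "?g (imp B (f a) (f b)) = imp A a b" if "a \<in> carrier A" "b \<in> carrier A" for a b
    using f(2) that g[OF meet_closed] g[OF join_closed] g[OF imp_closed]
    unfolding heyting_hom_def by metis+
  moreover have "?g (falsum B) = falsum A" "?g (verum B) = verum A"
    using f(2) g falsum_closed verum_closed unfolding heyting_hom_def by metis+
  ultimately show ?thesis
    using g by (auto simp: embedding_def heyting_hom_def sub_def inj_on_def)
qed

lemma subalgebra_of_sub: "subalgebra T (sub A S) \<longleftrightarrow> T \<subseteq> S \<and> subalgebra T A" if "S \<subseteq> carrier A"
  using that by (auto simp: subalgebra_def sub_def)

lemma next_stage_subalgebra:
  assumes "heyting_algebra H" "subalgebra C H" "next_stage H n C C'"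
  shows "subalgebra C' H" "C \<subseteq> C'"
proof -
  obtain ps where "adjoin_all H ps C C'" using assms(3) unfolding next_stage_def by blast
  from adjoin_all_subalgebra[OF assms(1,2) this] show "subalgebra C' H" "C \<subseteq> C'" by auto
qed

text \<open>The stage adjoins a representative isomorphic to \<open>B\<close> over \<open>A\<close>;
  composing with the isomorphism places \<open>B\<close> itself in \<open>C'\<close>.\<close>

lemma next_stage_minimal_extension:
  assumes "heyting_algebra H" "subalgebra C H" "next_stage H n C C'"
    and "subalgebra A H" "A \<subseteq> C" "card (join_irreducibles (sub H A)) \<le> n"
    and "minimal_extension (sub H A) (B, e)"
  shows "\<exists>f. embedding f B H \<and> f ` carrier B \<subseteq> C'"
proof -
  obtain ABs where ABs: "set (map fst ABs) =
        {A. subalgebra A (sub H C) \<and> card (join_irreducibles (sub H A)) \<le> n}"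
      "\<forall>(A, Bs)\<in>set ABs. extension_representatives (sub H A) Bs"
      "adjoin_all H (concat (map (\<lambda>(A, Bs). map (Pair A) Bs) ABs)) C C'"
    using assms(3) unfolding next_stage_def by blast
  have "subalgebra A (sub H C)"
    using assms(2,4,5) by (subst subalgebra_of_sub) (auto simp: subalgebra_def)
  then have "A \<in> set (map fst ABs)" using ABs(1) assms(6) by blast
  then obtain Bs where Bs: "(A, Bs) \<in> set ABs" by auto
  then have "extension_representatives (sub H A) Bs" using ABs(2) by blast
  then obtain Y where Y: "Y \<in> set Bs" "isomorphic_over (sub H A) (B, e) Y"
    using assms(7) unfolding extension_representatives_def by blast
  obtain B' e' where Y': "Y = (B', e')" by (cases Y)
  obtain k where k: "isomorphism k B B'" using Y(2) Y' by auto
  have "(A, B', e') \<in> set (concat (map (\<lambda>(A, Bs). map (Pair A) Bs) ABs))"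
    using Bs Y(1) Y' by force
  then obtain f where f: "embedding f B' H" "f ` carrier B' \<subseteq> C'"
    using adjoin_all_subalgebra[OF assms(1,2) ABs(3)] by blast
  have "embedding (f \<circ> k) B H"
    using isomorphism_imp_embedding[OF k] f(1) by (rule embedding_comp)
  moreover have "(f \<circ> k) ` carrier B \<subseteq> C'"
    using f(2) k by (auto simp: isomorphism_def bij_betw_def)
  ultimately show ?thesis by blast
qed

lemma two_element_subalgebra:
  assumes "heyting_algebra H"
  shows "subalgebra {falsum H, verum H} H"
    and "nontrivial H \<Longrightarrow> heyting_algebra K \<Longrightarrow> nontrivial K \<Longrightarrow>
      embedding (\<lambda>x. if x = falsum H then falsum K else verum K) (sub H {falsum H, verum H}) K"
proof -
  \<comment> \<open>The truth tables, stated for an arbitrary algebra because they are applied to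
    both \<open>H\<close> and \<open>K\<close>.\<close>
  have ops: "meet A (falsum A) (falsum A) = falsum A" "meet A (falsum A) (verum A) = falsum A"
    "meet A (verum A) (falsum A) = falsum A" "meet A (verum A) (verum A) = verum A"
    "join A (falsum A) (falsum A) = falsum A" "join A (falsum A) (verum A) = verum A"
    "join A (verum A) (falsum A) = verum A" "join A (verum A) (verum A) = verum A"
    "imp A (falsum A) (falsum A) = verum A" "imp A (falsum A) (verum A) = verum A"
    "imp A (verum A) (falsum A) = falsum A" "imp A (verum A) (verum A) = verum A"
    if "heyting_algebra A" for A :: "'x heyting"
  proof -
    interpret heyting_algebra A by fact
    note c = falsum_closed verum_closed
    show m: "meet A (falsum A) (falsum A) = falsum A" "meet A (falsum A) (verum A) = falsum A"
      "meet A (verum A) (falsum A) = falsum A" "meet A (verum A) (verum A) = verum A"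
      using falsum_le[OF c(1)] falsum_le[OF c(2)] le_verum[OF c(2)] meet_comm[OF c]
      by (simp_all add: le_def)
    show "join A (falsum A) (falsum A) = falsum A" "join A (falsum A) (verum A) = verum A"
      "join A (verum A) (falsum A) = verum A" "join A (verum A) (verum A) = verum A"
      using le_iff_join[OF c(1) c(1)] le_iff_join[OF c] le_iff_join[OF c(2) c(2)] join_comm[OF c] m
      by (simp_all add: le_def)
    have top: "a = verum A" if "le A (verum A) a" "a \<in> carrier A" for a
      using that le_antisym le_verum c(2) by blast
    have top_imp: "imp A a b = verum A" if "a \<in> carrier A" "b \<in> carrier A" "le A a b" for a b
    proof (rule top)
      have "meet A (verum A) a = a" using that le_verum[of a] meet_comm[of a] c(2) by (simp add: le_def)
      then show "le A (verum A) (imp A a b)" using residuation[of "verum A" a b] that c by simp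
    qed (use that imp_closed in blast)
    show "imp A (falsum A) (falsum A) = verum A" "imp A (falsum A) (verum A) = verum A"
      "imp A (verum A) (verum A) = verum A"
      by (rule top_imp[OF c(1) c(1) falsum_le[OF c(1)]], rule top_imp[OF c falsum_le[OF c(2)]],
        rule top_imp[OF c(2) c(2) le_refl[OF c(2)]])
    let ?n = "imp A (verum A) (falsum A)"
    have n: "?n \<in> carrier A" using c imp_closed by blast
    have "meet A ?n (verum A) = ?n" using le_verum[OF n] by (simp add: le_def)
    then have "le A ?n (falsum A)" using residuation[OF n c(2) c(1)] le_refl[OF n] by simp
    then show "?n = falsum A" using falsum_le[OF n] le_antisym n c by blast
  qed
  interpret heyting_algebra H by fact
  show "subalgebra {falsum H, verum H} H"
    using falsum_closed verum_closed by (auto simp: subalgebra_def ops[OF assms])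
  assume H: "nontrivial H" "heyting_algebra K" "nontrivial K"
  have "falsum H \<noteq> verum H" "falsum K \<noteq> verum K" using H by (auto simp: nontrivial_def)
  moreover have "falsum K \<in> carrier K" "verum K \<in> carrier K"
    using H(2) by (auto simp: heyting_algebra_def)
  ultimately show "embedding (\<lambda>x. if x = falsum H then falsum K else verum K) (sub H {falsum H, verum H}) K"
    by (auto simp: embedding_def heyting_hom_def sub_def inj_on_def ops[OF assms] ops[OF H(2)])
qed

lemma H0_chain_subalgebra:
  assumes "heyting_algebra H" "H0_chain H Hs"
  shows "subalgebra (Hs n) H" "m \<le> n \<Longrightarrow> Hs m \<subseteq> Hs n"
proof -
  have chain: "Hs 0 = {falsum H, verum H}" "\<And>n. next_stage H n (Hs n) (Hs (Suc n))"
    using assms(2) by (auto simp: H0_chain_def)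
  have sub: "subalgebra (Hs n) H" for n
  proof (induction n)
    case 0
    then show ?case unfolding chain(1) by (rule two_element_subalgebra(1)[OF assms(1)])
  next
    case (Suc n)
    then show ?case using chain(2) by (rule next_stage_subalgebra(1)[OF assms(1)])
  qed
  then show "subalgebra (Hs n) H" .
  show "Hs m \<subseteq> Hs n" if "m \<le> n"
    using next_stage_subalgebra(2)[OF assms(1) sub chain(2)] that
    by (rule lift_Suc_mono_le[of Hs])
qed

lemma H0_chain_Union_subalgebra:
  assumes "heyting_algebra H" "H0_chain H Hs"
  shows "subalgebra (\<Union>n. Hs n) H"
proof -
  note Hs = H0_chain_subalgebra[OF assms]
  have common: "\<exists>k. a \<in> Hs k \<and> b \<in> Hs k" if "a \<in> Hs m" "b \<in> Hs n" for a b m n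
    using that Hs(2)[of m "max m n"] Hs(2)[of n "max m n"] by auto
  have "meet H a b \<in> (\<Union>n. Hs n) \<and> join H a b \<in> (\<Union>n. Hs n) \<and> imp H a b \<in> (\<Union>n. Hs n)"
    if ab: "a \<in> (\<Union>n. Hs n)" "b \<in> (\<Union>n. Hs n)" for a b
  proof -
    obtain k where k: "a \<in> Hs k" "b \<in> Hs k" using common ab by blast
    then have "meet H a b \<in> Hs k" "join H a b \<in> Hs k" "imp H a b \<in> Hs k"
      using Hs(1)[of k] by (simp_all add: subalgebra_def)
    then show ?thesis by blast
  qed
  moreover have "(\<Union>n. Hs n) \<subseteq> carrier H"
    using Hs(1) by (auto simp: subalgebra_def)
  moreover have "falsum H \<in> Hs 0" "verum H \<in> Hs 0"
    using Hs(1)[of 0] by (auto simp: subalgebra_def)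
  ultimately show ?thesis unfolding subalgebra_def by blast
qed

text \<open>Among the subalgebras of \<open>A\<close> that embed into some stage take a maximal one,
  \<open>S\<close>. Were it proper, a minimal subalgebra \<open>T\<close> above it would be a
  minimal extension of the image of \<open>S\<close>, and a later stage would contain a copy of
  \<open>T\<close>.\<close>

lemma finite_algebra_embeds:
  fixes A :: "nat heyting"
  assumes H: "heyting_algebra H" "nontrivial H" "H0_chain H Hs"
    and A: "heyting_algebra A" "nontrivial A" "finite (carrier A)"
  shows "\<exists>f. embedding f A (sub H (\<Union>n. Hs n))"
proof -
  note Hs = H0_chain_subalgebra[OF H(1,3)]
  \<comment> \<open>The embedding is chosen anew for each \<open>S\<close>. The two-element
    subalgebra satisfies \<open>P\<close> through \<open>Hs 0\<close>.\<close>
  define P where "P S \<longleftrightarrow> subalgebra S A \<and> (\<exists>f n. embedding f (sub A S) H \<and> f ` S \<subseteq> Hs n)" for S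
  let ?two = "{falsum A, verum A}"
  have "(\<lambda>x. if x = falsum A then falsum H else verum H) ` ?two \<subseteq> Hs 0"
    using H(3) by (auto simp: H0_chain_def)
  then have "P ?two"
    using two_element_subalgebra[OF A(1)] A H unfolding P_def by blast
  moreover have fin: "finite {S. P S}"
    by (rule finite_subset[of _ "Pow (carrier A)"]) (use A(3) in \<open>auto simp: P_def subalgebra_def\<close>)
  ultimately obtain S where S: "P S" and maxS: "\<And>S'. P S' \<Longrightarrow> S \<subseteq> S' \<Longrightarrow> S' = S"
    using finite_has_maximal[of "{S. P S}"] by blast
  then obtain f n where f: "subalgebra S A" "embedding f (sub A S) H" "f ` S \<subseteq> Hs n"
    unfolding P_def by blast
  have hS: "heyting_algebra (sub A S)" using A(1) f(1) by (rule heyting_algebra_sub)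
  have cS: "carrier (sub A T) = T" and cH: "carrier (sub H U) = U" for T U by (simp_all add: sub_def)
  have SA: "S \<subseteq> carrier A" using f(1) by (simp add: subalgebra_def)
  have "S = carrier A"
  proof (rule ccontr)
    assume "S \<noteq> carrier A"
    let ?\<E> = "{T. subalgebra T A \<and> S \<subset> T}"
    interpret A: heyting_algebra A by fact
    have "carrier A \<in> ?\<E>"
      using SA \<open>S \<noteq> carrier A\<close> by (auto simp: subalgebra_def A.meet_closed A.join_closed
        A.imp_closed A.falsum_closed A.verum_closed)
    moreover have "finite ?\<E>"
      by (rule finite_subset[of _ "Pow (carrier A)"]) (use A(3) in \<open>auto simp: subalgebra_def\<close>)
    \<comment> \<open>Minimality of \<open>T\<close> above \<open>S\<close> leaves no subalgebra
      strictly between them, as \<open>minimal_extension\<close> demands.\<close>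
    ultimately have "\<exists>T\<in>?\<E>. \<forall>T'\<in>?\<E>. T' \<subseteq> T \<longrightarrow> T = T'"
      using finite_has_minimal[of ?\<E>] by blast
    then obtain T where T: "subalgebra T A" "S \<subset> T"
      and min: "\<forall>T'\<in>?\<E>. T' \<subseteq> T \<longrightarrow> T = T'"
      by blast
    have TA: "T \<subseteq> carrier A" using T(1) by (simp add: subalgebra_def)
    \<comment> \<open>The construction extends subalgebras of \<open>H\<close>, so \<open>T\<close>
      is regarded as an extension of the image of \<open>S\<close> under \<open>f\<close> by way of
      the inverse of \<open>f\<close>.\<close>
    let ?e = "inv_into S f"
    have fS: "subalgebra (f ` S) H"
      using f(2) heyting_hom_subalgebra_image[of f "sub A S" H S] f(1)
      by (auto simp: embedding_def subalgebra_of_sub[OF SA])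
    have e: "embedding ?e (sub H (f ` S)) (sub A S)"
      using embedding_inv_into[OF hS f(2)] by (simp add: cS)
    have eS: "?e ` f ` S = S"
      using f(2) by (auto simp: embedding_def cS image_image)
    have "embedding ?e (sub H (f ` S)) (sub A T)"
      using e T(2) by (auto simp: embedding_def heyting_hom_def sub_def)
    moreover have "heyting_algebra (sub A T)" using A(1) T(1) by (rule heyting_algebra_sub)
    moreover have "finite T" using TA A(3) by (rule finite_subset)
    moreover have "U = S \<or> U = T" if "subalgebra U (sub A T)" "S \<subseteq> U" for U
      using that min unfolding subalgebra_of_sub[OF TA] by blast
    ultimately have ext: "minimal_extension (sub H (f ` S)) (sub A T, ?e)"
      using T(2) cH by (auto simp: cS eS)
    \<comment> \<open>Stage \<open>?N\<close> handles only subalgebras with at most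
      \<open>?N\<close> join-irreducibles, so the index must bound that number as well as be late
      enough to contain the image of \<open>S\<close>.\<close>
    let ?N = "max n (card (join_irreducibles (sub H (f ` S))))"
    have "f ` S \<subseteq> Hs ?N" using f(3) Hs(2)[of n ?N] by auto
    moreover have "next_stage H ?N (Hs ?N) (Hs (Suc ?N))" using H(3) by (simp add: H0_chain_def)
    ultimately obtain g where "embedding g (sub A T) H" "g ` carrier (sub A T) \<subseteq> Hs (Suc ?N)"
      using next_stage_minimal_extension[OF H(1) Hs(1) _ fS _ max.cobounded2 ext] by blast
    then have "P T" using T(1) unfolding P_def cS by blast
    then show False using maxS T(2) by blast
  qed
  then have "embedding f A H" "f ` carrier A \<subseteq> (\<Union>n. Hs n)" using f by (auto simp: sub_def)
  then have "embedding f A (sub H (\<Union>n. Hs n))"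
    by (simp add: embedding_def heyting_hom_def sub_def)
  then show ?thesis by blast
qed

section \<open>Adding a root: the Kleene slash\<close>

text \<open>\<open>slash H v \<phi>\<close> says that \<open>\<phi>\<close> takes the value \<open>1\<close> in the algebra obtained from \<open>H\<close> by adjoining
  a new greatest element above the old one, which makes \<open>1\<close> join-prime; a variable gets the new
  value \<open>1\<close> precisely when it had the old one.\<close>

primrec slash :: "'a heyting \<Rightarrow> (nat \<Rightarrow> 'a) \<Rightarrow> fm \<Rightarrow> bool" where
  "slash H v (Var i) \<longleftrightarrow> v i = verum H"
| "slash H v Fls \<longleftrightarrow> False"
| "slash H v Tru \<longleftrightarrow> True"
| "slash H v (Conj \<phi> \<psi>) \<longleftrightarrow> slash H v \<phi> \<and> slash H v \<psi>"
| "slash H v (Disj \<phi> \<psi>) \<longleftrightarrow> slash H v \<phi> \<or> slash H v \<psi>"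
| "slash H v (Imp \<phi> \<psi>) \<longleftrightarrow> (slash H v \<phi> \<longrightarrow> slash H v \<psi>) \<and> eval H v (Imp \<phi> \<psi>) = verum H"

context heyting_algebra
begin

lemma verum_le_iff: "a \<in> carrier H \<Longrightarrow> le H (verum H) a \<longleftrightarrow> a = verum H"
  using le_antisym le_verum verum_closed le_refl by metis

lemma meet_eq_verum_iff:
  assumes "a \<in> carrier H" "b \<in> carrier H"
  shows "meet H a b = verum H \<longleftrightarrow> a = verum H \<and> b = verum H"
proof
  assume ab: "meet H a b = verum H"
  have "meet H (verum H) a = verum H"
    using ab meet_assoc[of a b a] meet_assoc[of a a b] meet_comm[of b a] le_refl[of a] assms
    by (metis le_def meet_assoc meet_comm)
  moreover have "meet H (verum H) b = verum H"
    using ab meet_assoc[of a b b] le_refl[of b] assms by (simp add: le_def)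
  ultimately show "a = verum H \<and> b = verum H"
    using verum_le_iff assms by (auto simp: le_def)
qed (use le_refl[OF verum_closed] in \<open>auto simp: le_def\<close>)

lemma join_eq_verum:
  assumes "a \<in> carrier H" "b \<in> carrier H" "a = verum H \<or> b = verum H"
  shows "join H a b = verum H"
  using assms le_verum le_iff_join join_comm verum_closed by metis

text \<open>Collapsing the new greatest element onto the old one is a homomorphism, so the value
  \<open>1\<close> above forces the value \<open>1\<close> in \<open>H\<close>.\<close>

lemma slash_imp_verum:
  assumes "\<And>i. v i \<in> carrier H"
  shows "slash H v \<phi> \<Longrightarrow> eval H v \<phi> = verum H"
  by (induction \<phi>)
    (auto simp: meet_eq_verum_iff verum_closed eval_closed assms intro!: join_eq_verum)

text \<open>Every rule but \<open>ImpI\<close> is immediate from the clauses. There the second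
  conjunct of the clause for \<open>Imp\<close> is required: the premise has value \<open>1\<close>
  by \<open>slash_imp_verum\<close>, and soundness passes this on to the implication.\<close>

lemma slash_sound:
  assumes v: "\<And>i. v i \<in> carrier H"
  shows "\<phi> \<turnstile> \<psi> \<Longrightarrow> slash H v \<phi> \<Longrightarrow> slash H v \<psi>"
proof (induction rule: derives.induct)
  case (ImpI \<chi> \<phi> \<psi>)
  have "\<chi> \<turnstile> Imp \<phi> \<psi>" using ImpI.hyps by (rule derives.ImpI)
  then have "le H (eval H v \<chi>) (eval H v (Imp \<phi> \<psi>))" by (rule soundness[OF v])
  moreover have "eval H v \<chi> = verum H" using ImpI.prems by (rule slash_imp_verum[OF v])
  moreover have "eval H v (Imp \<phi> \<psi>) \<in> carrier H" by (intro eval_closed v)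
  ultimately have "eval H v (Imp \<phi> \<psi>) = verum H" by (simp only: verum_le_iff)
  then show ?case using ImpI by simp
qed auto

text \<open>Adding the root changes nothing where truth in \<open>H\<close> is already described by
  a prime filter: primeness handles disjunctions, modus ponens handles implications.\<close>

lemma slash_iff_mem_Es:
  assumes "x \<in> Es V"
    and agree: "\<And>\<phi>. vars \<phi> \<subseteq> V \<Longrightarrow> degree \<phi> \<le> m \<Longrightarrow> eval H v \<phi> = verum H \<longleftrightarrow> cls \<phi> \<in> x"
  shows "vars \<phi> \<subseteq> V \<Longrightarrow> degree \<phi> \<le> m \<Longrightarrow> slash H v \<phi> \<longleftrightarrow> cls \<phi> \<in> x"
proof (induction \<phi>)
  case (Var i)
  then show ?case using agree[of "Var i"] by simp
next
  case (Conj \<phi> \<psi>)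
  then have "cls (Conj \<phi> \<psi>) \<in> x \<longleftrightarrow> cls \<phi> \<in> x \<and> cls \<psi> \<in> x"
    using Es_closed(4)[OF assms(1), of \<phi> \<psi>] Es_closed(3)[OF assms(1) _ _ derives.ConjE1, of \<phi> \<psi>]
      Es_closed(3)[OF assms(1) _ _ derives.ConjE2, of \<psi> \<phi>] by auto
  then show ?case using Conj by simp
next
  case (Disj \<phi> \<psi>)
  then have "cls (Disj \<phi> \<psi>) \<in> x \<longleftrightarrow> cls \<phi> \<in> x \<or> cls \<psi> \<in> x"
    using Es_closed(5)[OF assms(1), of \<phi> \<psi>] Es_closed(3)[OF assms(1) _ _ derives.DisjI1, of \<phi> \<psi>]
      Es_closed(3)[OF assms(1) _ _ derives.DisjI2, of \<phi> \<psi>] by auto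
  then show ?case using Disj by simp
next
  case (Imp \<phi> \<psi>)
  have "cls \<psi> \<in> x" if "cls (Imp \<phi> \<psi>) \<in> x" "cls \<phi> \<in> x"
    using Es_closed(3)[OF assms(1) _ Es_closed(4)[OF assms(1) that]
      derives.ImpE[OF derives.refl]] Imp.prems by simp
  then show ?case using Imp agree[OF Imp.prems] by auto
qed (use Es_closed(1,2)[OF assms(1)] in auto)

end

section \<open>The metric and the index\<close>

lemma sim_antimono: "sim V n x y \<Longrightarrow> k \<le> n \<Longrightarrow> sim V k x y"
  unfolding sim_def by (meson le_trans)

text \<open>Agreement up to degree \<open>n\<close> entails agreement up to all smaller degrees, so
  it holds iff the first disagreement lies strictly beyond \<open>n\<close>; this strictness is that
  of the inequality between distances.\<close>

lemma delta_less_iff_sim: "delta V x y < 1 / 2 ^ n \<longleftrightarrow> sim V n x y"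
proof -
  let ?S = "{enat d |d. \<not> sim V d x y}"
  have "delta V x y < 1 / 2 ^ n \<longleftrightarrow> enat n < Inf ?S"
    unfolding delta_def two_pow_neg_def
    by (cases "Inf ?S") (simp_all add: field_simps)
  also have "\<dots> \<longleftrightarrow> sim V n x y"
  proof
    assume "enat n < Inf ?S"
    then show "sim V n x y" using Inf_lower[of "enat n" ?S] leD by blast
  next
    assume n: "sim V n x y"
    \<comment> \<open>A lower bound on all elements gives only a weak inequality for the infimum,
      hence the passage to \<open>Suc n\<close>.\<close>
    have "enat (Suc n) \<le> Inf ?S"
    proof (rule Inf_greatest)
      fix e assume "e \<in> ?S"
      then obtain k where "e = enat k" "\<not> sim V k x y" by blast
      then show "enat (Suc n) \<le> e" using sim_antimono[OF n, of k] by (cases "k \<le> n") simp_all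
    qed
    then show "enat n < Inf ?S" unfolding Suc_ile_eq .
  qed
  finally show ?thesis .
qed

text \<open>A finite infimum in \<open>enat\<close> is attained, so \<open>n\<close> itself has the
  property over which the infimum is taken.\<close>

lemma h_index_enatD:
  assumes "h_index l d A = enat n"
    and "as \<in> tuples A l" "as' \<in> tuples A l" "Th A n as = Th A n as'" "S \<in> systems l d"
  shows "solvable A S as \<longleftrightarrow> solvable A S as'"
proof -
  let ?N = "{enat n | n. \<forall>as\<in>tuples A l. \<forall>as'\<in>tuples A l. Th A n as = Th A n as' \<longrightarrow>
       (\<forall>S\<in>systems l d. solvable A S as \<longleftrightarrow> solvable A S as')}"
  have Inf: "Inf ?N = enat n" using assms(1) unfolding h_index_def .
  then have "?N \<noteq> {}" by (metis Inf_enat_def enat.distinct(1))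
  then have "Inf ?N \<in> ?N" unfolding Inf_enat_def by (metis (mono_tags, lifting) LeastI_ex ex_in_conv)
  then show ?thesis using assms(2-) unfolding Inf by blast
qed

section \<open>Finite conjunctions and disjunctions\<close>

lemma foldr_Conj:
  "vars (foldr Conj L Tru) = (\<Union>\<phi>\<in>set L. vars \<phi>)"
  "(\<And>\<phi>. \<phi> \<in> set L \<Longrightarrow> degree \<phi> \<le> d) \<Longrightarrow> degree (foldr Conj L Tru) \<le> d"
  "slash H v (foldr Conj L Tru) \<longleftrightarrow> (\<forall>\<phi>\<in>set L. slash H v \<phi>)"
  "prime_theory T \<Longrightarrow> foldr Conj L Tru \<in> T \<longleftrightarrow> set L \<subseteq> T"
  by (induction L) (auto simp: prime_theoryD(1) prime_theory_Conj)

lemma (in heyting_algebra) eval_foldr_Conj: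
  assumes "\<And>i. v i \<in> carrier H"
  shows "eval H v (foldr Conj L Tru) = verum H \<longleftrightarrow> (\<forall>\<phi>\<in>set L. eval H v \<phi> = verum H)"
  by (induction L) (simp_all add: meet_eq_verum_iff eval_closed assms)

lemma foldr_Disj:
  "slash H v (foldr Disj L Fls) \<longleftrightarrow> (\<exists>\<phi>\<in>set L. slash H v \<phi>)"
  "prime_theory T \<Longrightarrow> foldr Disj L Fls \<in> T \<longleftrightarrow> set L \<inter> T \<noteq> {}"
  by (induction L) (auto simp: prime_theoryD(2) prime_theory_Disj)

text \<open>An embedding preserves and reflects the value \<open>1\<close>, so the finite model of
  \<open>x\<close> can be moved into the union of the chain, at any accuracy
  \<open>m\<close>.\<close>

lemma model_in_H0:
  assumes H: "heyting_algebra H" "nontrivial H" "H0_chain H Hs"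
    and "finite V" "x \<in> Es V"
  obtains v where "\<And>i. v i \<in> (\<Union>n. Hs n)"
    "\<And>\<phi>. vars \<phi> \<subseteq> V \<Longrightarrow> degree \<phi> \<le> m \<Longrightarrow> eval H v \<phi> = verum H \<longleftrightarrow> cls \<phi> \<in> x"
proof -
  let ?K = "sub H (\<Union>n. Hs n)"
  obtain A :: "nat heyting" and v where A: "heyting_algebra A" "finite (carrier A)"
    and v: "\<And>i. v i \<in> carrier A"
    and eval: "\<And>\<phi>. vars \<phi> \<subseteq> V \<Longrightarrow> degree \<phi> \<le> m \<Longrightarrow> eval A v \<phi> = verum A \<longleftrightarrow> cls \<phi> \<in> x"
    using finite_model[OF assms(4,5), of m] by blast
  interpret A: heyting_algebra A by fact
  \<comment> \<open>Since \<open>cls Fls \<notin> x\<close>, falsum does not take the value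
    \<open>1\<close> in the model; only nontrivial algebras embed.\<close>
  have "nontrivial A"
    using eval[of Fls] Es_closed(2)[OF assms(5)] by (simp add: nontrivial_def)
  then obtain f where f: "embedding f A ?K"
    using finite_algebra_embeds[OF H A(1) _ A(2)] by blast
  show thesis
  proof (rule that)
    show "f (v i) \<in> (\<Union>n. Hs n)" for i
      using f v[of i] by (auto simp: embedding_def heyting_hom_def sub_def)
    fix \<phi> assume \<phi>: "vars \<phi> \<subseteq> V" "degree \<phi> \<le> m"
    have "eval ?K (\<lambda>i. f (v i)) \<phi> = f (eval A v \<phi>)"
      using f v by (intro eval_hom A(1)) (auto simp: embedding_def)
    moreover have "f (verum A) = verum H"
      using f by (simp add: embedding_def heyting_hom_def sub_def)
    moreover have "f (eval A v \<phi>) = f (verum A) \<longleftrightarrow> eval A v \<phi> = verum A"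
      using f v by (intro inj_on_eq_iff[of f "carrier A"] A.eval_closed A.verum_closed)
        (auto simp: embedding_def)
    ultimately show "eval H (\<lambda>i. f (v i)) \<phi> = verum H \<longleftrightarrow> cls \<phi> \<in> x"
      using eval[OF \<phi>] by (simp add: eval_sub)
  qed
qed

theorem theorem5p2:
  fixes Htilde :: "'a heyting" and Hs :: "nat \<Rightarrow> 'a set"
    and l d :: nat and y x\<^sub>0 :: "fm set set"
  assumes "existentially_closed Htilde" and "nontrivial Htilde" and "H0_chain Htilde Hs"
    and "y \<in> Es {..<l}" and "x\<^sub>0 \<in> Es {..<Suc l}"
    and "delta {..<l} y (x\<^sub>0 \<inter> carrier (free_heyting {..<l}))
           < two_pow_neg (h_index l d (sub Htilde (\<Union>n. Hs n)))"
  shows "\<exists>x\<in>Es {..<Suc l}. x \<inter> carrier (free_heyting {..<l}) = y \<and>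
           delta {..<Suc l} x x\<^sub>0 < 1 / 2 ^ d"
proof -
  let ?U = "\<Union>n. Hs n"
  let ?K = "sub Htilde ?U"
  have H: "heyting_algebra Htilde" using assms(1) by (simp add: existentially_closed_def)
  have K: "carrier ?K = ?U" "verum ?K = verum Htilde" by (simp_all add: sub_def)
  \<comment> \<open>If the index were infinite, the right-hand side of the hypothesis would be
    \<open>0\<close>, which no distance lies below.\<close>
  have "0 \<le> delta {..<l} y (x\<^sub>0 \<inter> carrier (free_heyting {..<l}))"
    by (simp add: delta_def two_pow_neg_def split: enat.split)
  then obtain n where n: "h_index l d ?K = enat n"
    using assms(6) by (cases "h_index l d ?K") (auto simp: two_pow_neg_def)
  have "sim {..<l} n y (x\<^sub>0 \<inter> carrier (free_heyting {..<l}))"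
    using assms(6) by (simp add: n two_pow_neg_def delta_less_iff_sim)
  moreover have "cls \<phi> \<in> carrier (free_heyting {..<l})" if "vars \<phi> \<subseteq> {..<l}" for \<phi>
    using that by (simp add: free_heyting_simps(1))
  ultimately have y_iff_x\<^sub>0: "cls \<phi> \<in> y \<longleftrightarrow> cls \<phi> \<in> x\<^sub>0"
    if "vars \<phi> \<subseteq> {..<l}" "degree \<phi> \<le> n" for \<phi>
    using that unfolding sim_def by blast

  \<comment> \<open>Finitely many representatives of the formulas of degree at most
    \<open>d\<close>, so that agreement with \<open>x\<^sub>0\<close> up to degree \<open>d\<close>
    can be written as a system.\<close>
  obtain R where R: "finite R" "R \<subseteq> bounded_fms {..<Suc l} d"
    "cls ` R = cls ` bounded_fms {..<Suc l} d"
    using finite_subset_image[OF finite_cls_bounded_fms[of "{..<Suc l}" d] subset_refl]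
    by (metis finite_lessThan)
  obtain ts where ts: "set ts = {\<rho> \<in> R. cls \<rho> \<in> x\<^sub>0}"
    using finite_list[of "{\<rho> \<in> R. cls \<rho> \<in> x\<^sub>0}"] R(1) by auto
  obtain ss where ss: "set ss = {\<rho> \<in> R. cls \<rho> \<notin> x\<^sub>0}"
    using finite_list[of "{\<rho> \<in> R. cls \<rho> \<notin> x\<^sub>0}"] R(1) by auto
  have R': "vars \<rho> \<subseteq> {..<Suc l}" "degree \<rho> \<le> d" if "\<rho> \<in> R" for \<rho>
    using that R(2) by auto
  have rep: "\<exists>\<rho>\<in>R. cls \<phi> = cls \<rho>" if "vars \<phi> \<subseteq> {..<Suc l}" "degree \<phi> \<le> d" for \<phi>
  proof -
    have "cls \<phi> \<in> cls ` R" unfolding R(3) using that by blast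
    then show ?thesis by blast
  qed
  let ?t = "foldr Conj ts Tru"
  \<comment> \<open>The system keeps the formulas of \<open>ss\<close> as separate inequations,
    whereas separation needs their disjunction; the slash bridges the two.\<close>
  let ?s = "foldr Disj ss Fls"
  have t: "vars ?t \<subseteq> {..<Suc l}" "degree ?t \<le> d"
    using R' ts unfolding foldr_Conj(1) by (auto intro!: foldr_Conj(2))
  have sys: "(?t, ss) \<in> systems l d" using t R' ss by (auto simp: systems_def)

  have "\<not> Conj \<alpha> ?t \<turnstile> Disj \<beta> ?s"
    if ab: "vars \<alpha> \<subseteq> {..<l}" "vars \<beta> \<subseteq> {..<l}" "cls \<alpha> \<in> y" "cls \<beta> \<notin> y" for \<alpha> \<beta>
  proof
    \<comment> \<open>Accurate enough to compare theories up to \<open>n\<close>, to read off the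
      system up to \<open>d\<close>, and to evaluate \<open>\<alpha>\<close> and
      \<open>\<beta>\<close>.\<close>
    define m where "m = n + d + degree \<alpha> + degree \<beta>"
    assume der: "Conj \<alpha> ?t \<turnstile> Disj \<beta> ?s"
    obtain v where v: "\<And>i. v i \<in> ?U"
      and evalv: "\<And>\<phi>. vars \<phi> \<subseteq> {..<l} \<Longrightarrow> degree \<phi> \<le> m \<Longrightarrow>
        eval Htilde v \<phi> = verum Htilde \<longleftrightarrow> cls \<phi> \<in> y"
      using model_in_H0[OF H assms(2,3) _ assms(4), of m] by auto
    obtain w where w: "\<And>i. w i \<in> ?U"
      and evalw: "\<And>\<phi>. vars \<phi> \<subseteq> {..<Suc l} \<Longrightarrow> degree \<phi> \<le> m \<Longrightarrow>
        eval Htilde w \<phi> = verum Htilde \<longleftrightarrow> cls \<phi> \<in> x\<^sub>0"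
      using model_in_H0[OF H assms(2,3) _ assms(5), of m] by auto
    let ?a = "map v [0..<l]" and ?b = "map w [0..<l]"
    have tup: "?a \<in> tuples ?K l" "?b \<in> tuples ?K l"
      using v w by (auto simp: tuples_def K(1))
    have "eval Htilde (\<lambda>i. ?a ! i) \<phi> = verum Htilde \<longleftrightarrow> eval Htilde (\<lambda>i. ?b ! i) \<phi> = verum Htilde"
      if \<phi>: "vars \<phi> \<subseteq> {..<l}" "degree \<phi> \<le> n" for \<phi>
    proof -
      have "eval Htilde (\<lambda>i. ?a ! i) \<phi> = eval Htilde v \<phi>" "eval Htilde (\<lambda>i. ?b ! i) \<phi> = eval Htilde w \<phi>"
        using \<phi>(1) by (auto intro!: eval_cong)
      moreover have "vars \<phi> \<subseteq> {..<Suc l}" "degree \<phi> \<le> m" using \<phi> by (auto simp: m_def)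
      ultimately show ?thesis using evalv evalw \<phi> y_iff_x\<^sub>0[OF \<phi>] by simp
    qed
    then have "Th ?K n ?a = Th ?K n ?b"
      unfolding Th_def by (auto simp: eval_sub K(2))
    note solvable_iff = h_index_enatD[OF n tup this sys]
    have snoc: "eval Htilde (\<lambda>i. (map u [0..<l] @ [c]) ! i) \<phi> =
        eval Htilde (\<lambda>i. if i < l then u i else c) \<phi>" if "vars \<phi> \<subseteq> {..<Suc l}" for u c \<phi>
      using that by (intro eval_cong) (auto simp: nth_append)
    have snoc_w: "eval Htilde (\<lambda>i. (?b @ [w l]) ! i) \<phi> = eval Htilde w \<phi>"
      if "vars \<phi> \<subseteq> {..<Suc l}" for \<phi>
      using that by (intro eval_cong) (auto simp: nth_append less_Suc_eq)
    interpret H: heyting_algebra Htilde by (rule H)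
    have U: "u \<in> carrier Htilde" if "u \<in> ?U" for u
      using that H0_chain_Union_subalgebra[OF H assms(3)] unfolding subalgebra_def by blast
    have "eval Htilde w \<rho> = verum Htilde \<longleftrightarrow> cls \<rho> \<in> x\<^sub>0" if "\<rho> \<in> R" for \<rho>
      using evalw[of \<rho>] R'[OF that] by (simp add: m_def)
    then have "eval Htilde w ?t = verum Htilde" "\<forall>\<rho>\<in>set ss. eval Htilde w \<rho> \<noteq> verum Htilde"
      using H.eval_foldr_Conj[of w ts] U w ts ss by auto
    \<comment> \<open>The solution is the value \<open>w l\<close> of the variable \<open>q\<close>
      in the model of \<open>x\<^sub>0\<close>.\<close>
    then have "solvable ?K (?t, ss) ?b"
      using w[of l] snoc_w t(1) R'(1) ss by (auto simp: eval_sub K intro!: bexI[of _ "w l"])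
    then obtain c where c: "c \<in> ?U" "eval Htilde (\<lambda>i. (?a @ [c]) ! i) ?t = verum Htilde"
      "\<forall>\<rho>\<in>set ss. eval Htilde (\<lambda>i. (?a @ [c]) ! i) \<rho> \<noteq> verum Htilde"
      unfolding solvable_iff[symmetric] by (auto simp: eval_sub K)
    \<comment> \<open>The model of \<open>y\<close>, with the transferred solution \<open>c\<close>
      as the value of \<open>q\<close>.\<close>
    define u where "u i = (if i < l then v i else c)" for i
    have u: "u i \<in> carrier Htilde" for i using v c(1) U by (simp add: u_def)
    have "eval Htilde u ?t = verum Htilde" "\<forall>\<rho>\<in>set ss. eval Htilde u \<rho> \<noteq> verum Htilde"
      using c(2,3) snoc[of _ v c] t(1) R'(1) ss by (auto simp: u_def[abs_def])
    \<comment> \<open>The system decides every representative: those in \<open>x\<^sub>0\<close> are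
      conjuncts of \<open>?t\<close>, the others are its inequations.\<close>
    then have uR: "eval Htilde u \<rho> = verum Htilde \<longleftrightarrow> cls \<rho> \<in> x\<^sub>0" if "\<rho> \<in> R" for \<rho>
      using that H.eval_foldr_Conj[of u ts, OF u] ts ss by auto
    have evalu: "eval Htilde u \<phi> = verum Htilde \<longleftrightarrow> cls \<phi> \<in> x\<^sub>0"
      if \<phi>: "vars \<phi> \<subseteq> {..<Suc l}" "degree \<phi> \<le> d" for \<phi>
    proof -
      obtain \<rho> where \<rho>: "\<rho> \<in> R" "cls \<phi> = cls \<rho>" using rep \<phi> by blast
      have "eval Htilde u \<phi> = eval Htilde u \<rho>"
        using \<rho>(2) H.soundness[of u, OF u] H.le_antisym H.eval_closed u unfolding cls_eq_iff by metis
      then show ?thesis using uR \<rho> by simp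
    qed
    have evalu_y: "eval Htilde u \<phi> = verum Htilde \<longleftrightarrow> cls \<phi> \<in> y"
      if "vars \<phi> \<subseteq> {..<l}" "degree \<phi> \<le> m" for \<phi>
    proof -
      have "eval Htilde u \<phi> = eval Htilde v \<phi>"
        using that(1) by (intro eval_cong) (auto simp: u_def)
      then show ?thesis using evalv that by simp
    qed
    \<comment> \<open>The same valuation \<open>u\<close> is compared with \<open>x\<^sub>0\<close>
      on \<open>{..<Suc l}\<close> up to degree \<open>d\<close> and, below, with \<open>y\<close>
      on \<open>{..<l}\<close> up to degree \<open>m\<close>. The slash treats disjunctions as
      prime, so \<open>Disj \<beta> ?s\<close> fails although its value in \<open>Htilde\<close> may
      be \<open>1\<close>.\<close>
    have "slash Htilde u \<rho> \<longleftrightarrow> cls \<rho> \<in> x\<^sub>0" if "\<rho> \<in> R" for \<rho>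
      using H.slash_iff_mem_Es[OF assms(5) evalu, of d \<rho>] R'[OF that] by simp
    then have "slash Htilde u ?t" "\<not> slash Htilde u ?s"
      using ts ss by (auto simp: foldr_Conj(3) foldr_Disj(1))
    moreover have "slash Htilde u \<alpha>" "\<not> slash Htilde u \<beta>"
      using H.slash_iff_mem_Es[OF assms(4) evalu_y, of m] ab by (auto simp: m_def)
    ultimately show False using H.slash_sound[of u, OF u der] by simp
  qed
  then obtain T where T: "prime_theory T" "spec {..<l} T = y" "?t \<in> T" "?s \<notin> T"
    using Es_prime_theory_separating[OF assms(4)] by blast
  \<comment> \<open>Containing \<open>?t\<close> and omitting \<open>?s\<close> is, for a prime
    theory, the same as agreeing with \<open>x\<^sub>0\<close> on all of \<open>R\<close>.\<close>
  have R_T: "\<rho> \<in> T \<longleftrightarrow> cls \<rho> \<in> x\<^sub>0" if "\<rho> \<in> R" for \<rho>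
    using T(3,4) that ts ss unfolding foldr_Conj(4)[OF T(1)] foldr_Disj(2)[OF T(1)] by blast
  let ?x = "spec {..<Suc l} T"
  have "?x \<in> Es {..<Suc l}" by (rule spec_Es[OF T(1)])
  moreover have "?x \<inter> carrier (free_heyting {..<l}) = y"
  proof
    show "?x \<inter> carrier (free_heyting {..<l}) \<subseteq> y"
    proof
      fix X assume X: "X \<in> ?x \<inter> carrier (free_heyting {..<l})"
      then obtain \<phi> where \<phi>: "X = cls \<phi>" "vars \<phi> \<subseteq> {..<l}" by (auto simp: free_heyting_simps(1))
      moreover have "vars \<phi> \<subseteq> {..<Suc l}" using \<phi>(2) by auto
      ultimately show "X \<in> y"
        using X cls_mem_spec[OF T(1)] unfolding T(2)[symmetric] by simp
    qed
    show "y \<subseteq> ?x \<inter> carrier (free_heyting {..<l})"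
      unfolding T(2)[symmetric] spec_def free_heyting_simps(1) by force
  qed
  moreover have "sim {..<Suc l} d ?x x\<^sub>0"
    unfolding sim_def
  proof (intro allI impI)
    fix \<phi> assume \<phi>: "vars \<phi> \<subseteq> {..<Suc l} \<and> degree \<phi> \<le> d"
    then obtain \<rho> where \<rho>: "\<rho> \<in> R" "cls \<phi> = cls \<rho>" using rep by blast
    then show "cls \<phi> \<in> ?x \<longleftrightarrow> cls \<phi> \<in> x\<^sub>0"
      using R_T cls_mem_spec[OF T(1) R'(1)] by simp
  qed
  ultimately show ?thesis unfolding delta_less_iff_sim by (intro bexI[of _ ?x] conjI)
qed

end
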